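(* Let $m=(m_0,m_1,\dots)$ be a bounded sequence of integers not less than $2$, and let $G_m$ be the associated bounded Vilenkin group. Let $0<p\leq 1/2$. Then there exists an absolute constant $c_p>0$, depending only on $p$, such that for all martingales $f\in H_p(G_m)$ and all $n=2,3,\dots$ $$\frac{1}{\log^{[1/2+p]} n}\sum_{k=1}^{n}\frac{\|\sigma_k f\|_p^p}{k^{2-2p}}\leq c_p\|f\|_{H_p}^p,$$ where $[x]$ denotes the integer part of $x$ and $\log^{[1/2+p]}n$ means $(\log n)^{[1/2+p]}$.
   Context: Notation. $\mathbb{P}_+$ is the set of positive integers and $\mathbb{P}=\mathbb{P}_+\cup\{0\}$. The sequence $m=(m_0,m_1,\dots)$ consists of integers $\ge 2$ with $\sup_n m_n<\infty$ and is fixed throughout. $Z_{m_k}=\{0,1,\dots,m_k-1\}$ is the additive group of integers modulo $m_k$ (discrete topology), and $G_m=\prod_{k\in\mathbb{P}} Z_{m_k}$ is the complete direct product with the product topology; its elements are sequences $x=(x_0,x_1,\dots)$ with $x_k\in Z_{m_k}$. $\mu$ is the Haar measure on $G_m$ with $\mu(G_m)=1$, i.e. the product of the measures $\mu_k(\{j\})=1/m_k$. Intervals: $I_0(x)=G_m$ and $I_n(x)=\{y\in G_m: y_0=x_0,\dots,y_{n-1}=x_{n-1}\}$. Number system: $M_0=1$, $M_{k+1}=m_kM_k$; every $n\in\mathbb{P}$ is uniquely $n=\sum_{j=0}^\infty n_jM_j$ with $n_j\in Z_{m_j}$, only finitely many $n_j$ nonzero. Vilenkin system: $r_k(x)=\exp(2\pi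 \imath x_k/m_k)$ (with $\imath^2=-1$) and $\psi_n(x)=\prod_{k=0}^\infty r_k(x)^{n_k}$ for $n\in\mathbb{P}$. Quasi-norm: $\|g\|_p=\left(\int_{G_m}|g|^p\,d\mu\right)^{1/p}$ for $0<p<\infty$. Martingales and Hardy spaces: $\digamma_n$ is the $\sigma$-algebra generated by $\{I_n(x):x\in G_m\}$. A martingale $f=(f^{(n)},n\in\mathbb{P})$ is taken with respect to $(\digamma_n,n\in\mathbb{P})$. Its maximal function is $f^*=\sup_{n\in\mathbb{P}}|f^{(n)}|$, and $H_p(G_m)$ is the set of all martingales with $\|f\|_{H_p}:=\|f^*\|_p<\infty$. Fourier coefficients, partial sums and Fejér means of a martingale $f$: $\widehat f(i)=\lim_{k\to\infty}\int_{G_m}f^{(k)}\overline{\psi_i}\,d\mu$ for $i\in\mathbb{P}$, $S_nf=\sum_{k=0}^{n-1}\widehat f(k)\psi_k$, and $\sigma_nf=\frac1n\sum_{k=1}^nS_kf$ for $n\in\mathbb{P}_+$. *)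

theory Defs
  imports "HOL-Probability.Probability"
begin

text \<open>
  The sequence \<open>m\<close> is a parameter of every notion below. An element of the Vilenkin group is a
  function \<open>x :: nat \<Rightarrow> nat\<close> with \<open>x k < m k\<close> for all \<open>k\<close>.
\<close>

definition vilenkin_group :: "(nat \<Rightarrow> nat) \<Rightarrow> (nat \<Rightarrow> nat) set" where
  "vilenkin_group m = {x. \<forall>k. x k < m k}"

definition vilenkin_measure :: "(nat \<Rightarrow> nat) \<Rightarrow> (nat \<Rightarrow> nat) measure" where
  "vilenkin_measure m = Pi\<^sub>M UNIV (\<lambda>k. uniform_count_measure {..<m k})"

definition vilenkin_interval :: "(nat \<Rightarrow> nat) \<Rightarrow> nat \<Rightarrow> (nat \<Rightarrow> nat) \<Rightarrow> (nat \<Rightarrow> nat) set" where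
  "vilenkin_interval m n x = {y \<in> vilenkin_group m. \<forall>k<n. y k = x k}"

definition vilenkin_filtration :: "(nat \<Rightarrow> nat) \<Rightarrow> nat \<Rightarrow> (nat \<Rightarrow> nat) measure" where
  "vilenkin_filtration m n =
     sigma (vilenkin_group m) {vilenkin_interval m n x | x. x \<in> vilenkin_group m}"

definition vilenkin_base :: "(nat \<Rightarrow> nat) \<Rightarrow> nat \<Rightarrow> nat" where
  "vilenkin_base m k = (\<Prod>i<k. m i)"

definition vilenkin_digit :: "(nat \<Rightarrow> nat) \<Rightarrow> nat \<Rightarrow> nat \<Rightarrow> nat" where
  "vilenkin_digit m n j = n div vilenkin_base m j mod m j"

definition rademacher :: "(nat \<Rightarrow> nat) \<Rightarrow> nat \<Rightarrow> (nat \<Rightarrow> nat) \<Rightarrow> complex" where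
  "rademacher m k x = exp (2 * of_real pi * \<i> * of_nat (x k) / of_nat (m k))"

text \<open>The infinite product is taken over the indices of the finitely many nonzero digits of \<open>n\<close>
  (finiteness is proved in \<open>finite_vilenkin_digit\<close> below).\<close>

definition vilenkin_fun :: "(nat \<Rightarrow> nat) \<Rightarrow> nat \<Rightarrow> (nat \<Rightarrow> nat) \<Rightarrow> complex" where
  "vilenkin_fun m n x =
     (\<Prod>k | vilenkin_digit m n k \<noteq> 0. rademacher m k x ^ vilenkin_digit m n k)"

text \<open>Power of an extended nonnegative real with a positive real exponent.\<close>

definition ennpowr :: "ennreal \<Rightarrow> real \<Rightarrow> ennreal" where
  "ennpowr x p = (if x = \<infinity> then \<infinity> else ennreal (enn2real x powr p))"

text \<open>The quasi-norm is defined for \<open>[0, \<infinity>]\<close>-valued functions, because the maximal function of a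
  martingale may be infinite; for a complex function \<open>g\<close> it is applied to the modulus of \<open>g\<close>.\<close>

definition vilenkin_Lp_norm :: "(nat \<Rightarrow> nat) \<Rightarrow> real \<Rightarrow> ((nat \<Rightarrow> nat) \<Rightarrow> ennreal) \<Rightarrow> ennreal" where
  "vilenkin_Lp_norm m p g = ennpowr (\<integral>\<^sup>+ x. ennpowr (g x) p \<partial>vilenkin_measure m) (1 / p)"

definition complex_cond_exp :: "'a measure \<Rightarrow> 'a measure \<Rightarrow> ('a \<Rightarrow> complex) \<Rightarrow> 'a \<Rightarrow> complex" where
  "complex_cond_exp M F g x =
     Complex (real_cond_exp M F (\<lambda>y. Re (g y)) x) (real_cond_exp M F (\<lambda>y. Im (g y)) x)"

definition vilenkin_martingale ::
    "(nat \<Rightarrow> nat) \<Rightarrow> (nat \<Rightarrow> (nat \<Rightarrow> nat) \<Rightarrow> complex) \<Rightarrow> bool" where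
  "vilenkin_martingale m f \<longleftrightarrow>
     (\<forall>n. f n \<in> borel_measurable (vilenkin_filtration m n)) \<and>
     (\<forall>n. integrable (vilenkin_measure m) (f n)) \<and>
     (\<forall>n k. n \<le> k \<longrightarrow>
        (AE x in vilenkin_measure m.
           complex_cond_exp (vilenkin_measure m) (vilenkin_filtration m n) (f k) x = f n x))"

definition maximal_fun :: "(nat \<Rightarrow> (nat \<Rightarrow> nat) \<Rightarrow> complex) \<Rightarrow> (nat \<Rightarrow> nat) \<Rightarrow> ennreal" where
  "maximal_fun f x = (SUP n. ennreal (cmod (f n x)))"

definition Hardy_norm ::
    "(nat \<Rightarrow> nat) \<Rightarrow> real \<Rightarrow> (nat \<Rightarrow> (nat \<Rightarrow> nat) \<Rightarrow> complex) \<Rightarrow> ennreal" where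
  "Hardy_norm m p f = vilenkin_Lp_norm m p (maximal_fun f)"

definition Hardy_space ::
    "(nat \<Rightarrow> nat) \<Rightarrow> real \<Rightarrow> (nat \<Rightarrow> (nat \<Rightarrow> nat) \<Rightarrow> complex) set" where
  "Hardy_space m p = {f. vilenkin_martingale m f \<and> Hardy_norm m p f < \<infinity>}"

definition vilenkin_coeff ::
    "(nat \<Rightarrow> nat) \<Rightarrow> (nat \<Rightarrow> (nat \<Rightarrow> nat) \<Rightarrow> complex) \<Rightarrow> nat \<Rightarrow> complex" where
  "vilenkin_coeff m f i = lim (\<lambda>k. LINT x|vilenkin_measure m. f k x * cnj (vilenkin_fun m i x))"

definition vilenkin_partial_sum ::
    "(nat \<Rightarrow> nat) \<Rightarrow> (nat \<Rightarrow> (nat \<Rightarrow> nat) \<Rightarrow> complex) \<Rightarrow> nat \<Rightarrow> (nat \<Rightarrow> nat) \<Rightarrow> complex" where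
  "vilenkin_partial_sum m f n x = (\<Sum>k<n. vilenkin_coeff m f k * vilenkin_fun m k x)"

definition fejer_mean ::
    "(nat \<Rightarrow> nat) \<Rightarrow> (nat \<Rightarrow> (nat \<Rightarrow> nat) \<Rightarrow> complex) \<Rightarrow> nat \<Rightarrow> (nat \<Rightarrow> nat) \<Rightarrow> complex" where
  "fejer_mean m f n x = (\<Sum>k=1..n. vilenkin_partial_sum m f k x) / of_nat n"


subsection \<open>Basic facts about the number system\<close>

lemma vilenkin_base_0 [simp]: "vilenkin_base m 0 = 1"
  by (simp add: vilenkin_base_def)

lemma vilenkin_base_Suc [simp]: "vilenkin_base m (Suc k) = m k * vilenkin_base m k"
  by (simp add: vilenkin_base_def)

lemma vilenkin_base_gt:
  assumes "\<And>k. 2 \<le> m k"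
  shows "n < vilenkin_base m n"
proof (induction n)
  case (Suc n)
  have "Suc n \<le> vilenkin_base m n" using Suc by simp
  then have "Suc n < 2 * vilenkin_base m n" by simp
  also have "\<dots> \<le> m n * vilenkin_base m n" using assms by (intro mult_right_mono) auto
  finally show ?case by simp
qed simp

lemma vilenkin_digit_less:
  assumes "\<And>k. 2 \<le> m k"
  shows "vilenkin_digit m n j < m j"
  unfolding vilenkin_digit_def using assms[of j] by (intro mod_less_divisor) simp

lemma finite_vilenkin_digit:
  assumes "\<And>k. 2 \<le> m k"
  shows "finite {j. vilenkin_digit m n j \<noteq> 0}"
proof (rule finite_subset)
  show "{j. vilenkin_digit m n j \<noteq> 0} \<subseteq> {..n}"
  proof
    fix j assume "j \<in> {j. vilenkin_digit m n j \<noteq> 0}"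
    then have "vilenkin_base m j \<le> n"
      by (metis (mono_tags) vilenkin_digit_def div_less mod_0 mem_Collect_eq not_le)
    with vilenkin_base_gt[of m j] assms show "j \<in> {..n}" by force
  qed
qed simp

lemma sum_vilenkin_digit_lessThan:
  "(\<Sum>j<k. vilenkin_digit m n j * vilenkin_base m j) = n mod vilenkin_base m k"
proof (induction k)
  case (Suc k)
  have "n mod (vilenkin_base m k * m k)
      = vilenkin_base m k * (n div vilenkin_base m k mod m k) + n mod vilenkin_base m k"
    by (rule mod_mult2_eq)
  then show ?case using Suc by (simp add: vilenkin_digit_def mult.commute)
qed simp

lemma sum_vilenkin_digit:
  assumes "\<And>k. 2 \<le> m k"
  shows "(\<Sum>j | vilenkin_digit m n j \<noteq> 0. vilenkin_digit m n j * vilenkin_base m j) = n"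
proof -
  define N where "N = Suc (Max (insert n {j. vilenkin_digit m n j \<noteq> 0}))"
  have fin: "finite (insert n {j. vilenkin_digit m n j \<noteq> 0})"
    using finite_vilenkin_digit[of m n] assms by simp
  have N: "j < N" if "j \<in> insert n {j. vilenkin_digit m n j \<noteq> 0}" for j
    unfolding N_def using Max_ge[OF fin that] by simp
  have "(\<Sum>j | vilenkin_digit m n j \<noteq> 0. vilenkin_digit m n j * vilenkin_base m j)
      = (\<Sum>j<N. vilenkin_digit m n j * vilenkin_base m j)"
    using N by (intro sum.mono_neutral_left) auto
  also have "\<dots> = n mod vilenkin_base m N" by (rule sum_vilenkin_digit_lessThan)
  also have "\<dots> = n"
    using N[of n] vilenkin_base_gt[of m N] assms by (intro mod_less) force
  finally show ?thesis .
qed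

lemma vilenkin_digit_unique:
  assumes m: "\<And>k. 2 \<le> m k" and d: "\<And>j. d j < m j" and fin: "finite {j. d j \<noteq> 0}"
    and n: "n = (\<Sum>j | d j \<noteq> 0. d j * vilenkin_base m j)"
  shows "vilenkin_digit m n = d"
proof
  fix i
  have pos: "0 < vilenkin_base m j" for j
    using m by (metis vilenkin_base_gt not_less_zero neq0_conv)
  have less: "(\<Sum>j<k. d j * vilenkin_base m j) < vilenkin_base m k" for k
  proof (induction k)
    case (Suc k)
    have "(\<Sum>j<Suc k. d j * vilenkin_base m j) < (d k + 1) * vilenkin_base m k"
      using Suc by simp
    also have "\<dots> \<le> m k * vilenkin_base m k"
      using d[of k] by (intro mult_right_mono) auto
    finally show ?case by simp
  qed simp
  have dvd: "vilenkin_base m i dvd vilenkin_base m j" if "i \<le> j" for i j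
    using that by (induction rule: dec_induct) auto
  define A where "A = {j. d j \<noteq> 0}"
  have split: "\<exists>q. n = (\<Sum>j<k. d j * vilenkin_base m j) + vilenkin_base m k * q" for k
  proof -
    have "n = (\<Sum>j\<in>A \<union> {..<k}. d j * vilenkin_base m j)"
      unfolding n using fin by (intro sum.mono_neutral_left) (auto simp: A_def)
    also have "A \<union> {..<k} = {..<k} \<union> (A - {..<k})" by auto
    also have "(\<Sum>j\<in>{..<k} \<union> (A - {..<k}). d j * vilenkin_base m j)
        = (\<Sum>j<k. d j * vilenkin_base m j) + (\<Sum>j\<in>A - {..<k}. d j * vilenkin_base m j)"
      using fin by (intro sum.union_disjoint) (auto simp: A_def)
    finally have eq: "n = \<dots>" .
    have "vilenkin_base m k dvd (\<Sum>j\<in>A - {..<k}. d j * vilenkin_base m j)"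
      by (intro dvd_sum dvd_mult dvd) auto
    with eq show ?thesis by (auto elim!: dvdE)
  qed
  have "n mod vilenkin_base m k = (\<Sum>j<k. d j * vilenkin_base m j)" for k
    using split[of k] less[of k] by auto
  then have "(\<Sum>j<k. vilenkin_digit m n j * vilenkin_base m j)
      = (\<Sum>j<k. d j * vilenkin_base m j)" for k
    by (simp add: sum_vilenkin_digit_lessThan)
  from this[of i] this[of "Suc i"]
  have "vilenkin_digit m n i * vilenkin_base m i = d i * vilenkin_base m i" by simp
  then show "vilenkin_digit m n i = d i" using pos[of i] by simp
qed


subsection \<open>Basic facts about the measure and the filtration\<close>

lemma prob_space_vilenkin_coordinate:
  fixes m :: "nat \<Rightarrow> nat"
  assumes "\<And>k. 2 \<le> m k"
  shows "prob_space (uniform_count_measure {..<m k})"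
proof (intro prob_space_uniform_count_measure)
  have "0 < m k" using assms[of k] by simp
  then show "{..<m k} \<noteq> {}" by auto
qed simp

lemma prob_space_vilenkin_measure:
  assumes "\<And>k. 2 \<le> m k"
  shows "prob_space (vilenkin_measure m)"
  unfolding vilenkin_measure_def using assms
  by (intro prob_space_PiM prob_space_vilenkin_coordinate) auto

lemma space_vilenkin_measure [simp]: "space (vilenkin_measure m) = vilenkin_group m"
  by (auto simp: vilenkin_measure_def vilenkin_group_def space_PiM space_uniform_count_measure
      PiE_def Pi_def)

lemma vilenkin_interval_eq_emb:
  assumes "x \<in> vilenkin_group m"
  shows "vilenkin_interval m n x =
    prod_emb UNIV (\<lambda>k. uniform_count_measure {..<m k}) {..<n} (Pi\<^sub>E {..<n} (\<lambda>k. {x k}))"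
  using assms
  by (auto simp: vilenkin_interval_def vilenkin_group_def prod_emb_def PiE_iff
      space_uniform_count_measure)

lemma sets_vilenkin_interval:
  assumes "x \<in> vilenkin_group m"
  shows "vilenkin_interval m n x \<in> sets (vilenkin_measure m)"
  unfolding vilenkin_interval_eq_emb[OF assms] vilenkin_measure_def
  using assms by (intro sets_PiM_I)
    (auto simp: sets_uniform_count_measure vilenkin_group_def)

lemma emeasure_vilenkin_interval:
  assumes m: "\<And>k. 2 \<le> m k" and x: "x \<in> vilenkin_group m"
  shows "emeasure (vilenkin_measure m) (vilenkin_interval m n x) = ennreal (1 / vilenkin_base m n)"
proof -
  interpret product_prob_space "\<lambda>k. uniform_count_measure {..<m k}" UNIV
    using m by (intro product_prob_spaceI prob_space_vilenkin_coordinate) auto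
  have x': "x k < m k" for k using x by (simp add: vilenkin_group_def)
  have "emeasure (vilenkin_measure m) (vilenkin_interval m n x)
      = (\<Prod>k<n. emeasure (uniform_count_measure {..<m k}) {x k})"
    unfolding vilenkin_interval_eq_emb[OF x] vilenkin_measure_def
    using x' by (intro emeasure_PiM_emb) (auto simp: sets_uniform_count_measure)
  also have "\<dots> = (\<Prod>k<n. ennreal (1 / m k))"
    using x' by (intro prod.cong refl) (simp add: emeasure_uniform_count_measure)
  also have "\<dots> = ennreal (1 / vilenkin_base m n)"
    by (subst prod_ennreal) (auto simp: vilenkin_base_def prod_dividef)
  finally show ?thesis .
qed

lemma subalgebra_vilenkin_filtration:
  "subalgebra (vilenkin_measure m) (vilenkin_filtration m n)"
proof -
  have sub: "{vilenkin_interval m n x | x. x \<in> vilenkin_group m} \<subseteq> Pow (vilenkin_group m)"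
    by (auto simp: vilenkin_interval_def)
  have "sigma_sets (space (vilenkin_measure m)) {vilenkin_interval m n x | x. x \<in> vilenkin_group m}
      \<subseteq> sets (vilenkin_measure m)"
    by (intro sets.sigma_sets_subset) (auto intro: sets_vilenkin_interval)
  with sub show ?thesis
    by (simp add: subalgebra_def vilenkin_filtration_def space_measure_of sets_measure_of)
qed

end

theory Submission
  imports Defs
begin

text \<open>
  For \<open>p \<le> 1\<close> the functional \<open>f \<mapsto> \<Sum>\<^sub>k k\<^bsup>2p-2\<^esup> \<parallel>\<sigma>\<^sub>k f\<parallel>\<^sub>p\<^sup>p\<close> is subadditive. Hence it is enough to bound
  it on atoms and to write a martingale as a sum of atoms at a cost controlled by its maximal
  function. An atom is a function \<open>g\<close> supported on one interval \<open>I\<close> of level \<open>N\<close> with \<open>|g| \<le> c\<close>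
  and mean zero; the two facts to prove are

  \<^item> the functional is at most \<open>C \<Lambda>(n) c\<^sup>p \<mu>(I)\<close> on such an atom, where \<open>\<Lambda>(n)\<close> is \<open>1\<close> for
    \<open>p < 1/2\<close> and \<open>log n\<close> for \<open>p = 1/2\<close> (\<open>atom_estimate\<close>);
  \<^item> \<open>f\<close> is a sum of atoms with \<open>\<Sum> c\<^sup>p \<mu>(I) \<le> C \<integral> (f\<^sup>*)\<^sup>p\<close> (\<open>fejer_energy_le\<close>).

  For \<open>k < M\<^sub>L\<close> the mean \<open>\<sigma>\<^sub>k f\<close> depends only on the martingale up to time \<open>L\<close>, and these functions
  live on the quotient of \<open>G\<^sub>m\<close> by \<open>I\<^sub>L(0)\<close>. So the whole argument is carried out with finite sums
  over that finite group, and the decomposition into atoms is finite: no convergence question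
  arises, and only the last part of the proof uses measure theory.

  For the first fact, the kernel \<open>n K\<^sub>n\<close> is dominated by the sum, over the levels \<open>a\<close> with
  \<open>M\<^sub>a \<le> n\<close>, of \<open>M\<^sub>a M\<^sub>s\<close> on the sets where the two arguments agree in the first \<open>a\<close> coordinates,
  except perhaps in coordinate \<open>s\<close> (\<open>norm_fejer_sum\<close>). Averaging this bound over \<open>I\<close> shows that
  \<open>\<sigma>\<^sub>n g\<close> at \<open>x\<close> is controlled by the same sets with \<open>a \<le> N\<close>, together with a term that does not
  depend on \<open>n\<close> (\<open>norm_fejer_op_le\<close>). Since such a set has measure at most \<open>B / M\<^sub>a\<close>, where \<open>B\<close>
  bounds the sequence \<open>m\<close>, taking \<open>p\<close>-th powers leaves \<open>\<Sum>\<^sub>a M\<^sub>a\<^bsup>2p-1\<^esup>\<close>, and the term that does not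
  depend on \<open>n\<close> leaves \<open>\<Sum>\<^sub>k k\<^bsup>2p-2\<^esup>\<close>. Both are bounded for \<open>p < 1/2\<close> and logarithmic for \<open>p = 1/2\<close>;
  this is the origin of the factor \<open>log n\<close>. The mean value zero makes \<open>\<sigma>\<^sub>n g\<close> vanish for
  \<open>n < M\<^sub>N\<close>, which starts the sum over \<open>n\<close> at \<open>M\<^sub>N\<close> and yields the factor \<open>\<mu>(I)\<close>.

  For the second fact, the initial value is subtracted, and \<open>f\<close> is stopped just before some value
  in the current interval exceeds the level \<open>\<theta>\<close>. The difference of the martingales stopped for
  \<open>2\<theta>\<close> and for \<open>\<theta>\<close> is bounded by \<open>3\<theta>\<close>, lives on the intervals where the stopping for \<open>\<theta>\<close> occurs,
  and has mean zero on each of them. Each of these intervals has a child on which \<open>f\<^sup>* > \<theta>\<close>, so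
  that their total measure is at most \<open>B \<mu>(f\<^sup>* > \<theta>)\<close>; summing \<open>\<theta>\<^sup>p \<mu>(f\<^sup>* > \<theta>)\<close> over a geometric
  sequence of levels gives \<open>\<integral> (f\<^sup>*)\<^sup>p\<close>.
\<close>

section \<open>Sums of powers of real numbers\<close>

text \<open>The fractions \<open>x / (x + y)\<close> and \<open>y / (x + y)\<close> add up to \<open>1\<close> and do not decrease under
  \<open>t \<mapsto> t\<^sup>p\<close>.\<close>

lemma powr_add_le:
  fixes x y p :: real
  assumes "0 \<le> x" "0 \<le> y" "0 < p" "p \<le> 1"
  shows "(x + y) powr p \<le> x powr p + y powr p"
proof (cases "x + y = 0")
  case True
  then show ?thesis by simp
next
  case False
  with assms have pos: "0 < x + y" by simp
  have frac: "z \<le> z powr p" if "0 \<le> z" "z \<le> 1" for z :: real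
  proof (cases "z = 0")
    case False
    then show ?thesis using powr_mono'[of p 1 z] that assms by simp
  qed simp
  have "1 = x / (x + y) + y / (x + y)" using pos by (simp add: add_divide_distrib[symmetric])
  also have "\<dots> \<le> (x / (x + y)) powr p + (y / (x + y)) powr p"
    using assms pos by (intro add_mono frac) auto
  also have "\<dots> = (x powr p + y powr p) / (x + y) powr p"
    using assms by (simp add: powr_divide add_divide_distrib)
  finally show ?thesis using pos by (simp add: le_divide_eq)
qed

lemma powr_sum_le:
  fixes f :: "'a \<Rightarrow> real"
  assumes "finite A" "\<And>a. a \<in> A \<Longrightarrow> 0 \<le> f a" "0 < p" "p \<le> 1"
  shows "(\<Sum>a\<in>A. f a) powr p \<le> (\<Sum>a\<in>A. f a powr p)"
  using assms(1,2)
proof (induction A rule: finite_induct)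
  case (insert a A)
  have "(f a + (\<Sum>a\<in>A. f a)) powr p \<le> f a powr p + (\<Sum>a\<in>A. f a) powr p"
    using insert assms by (intro powr_add_le sum_nonneg) auto
  also have "\<dots> \<le> f a powr p + (\<Sum>a\<in>A. f a powr p)" using insert by auto
  finally show ?case using insert by simp
qed simp

text \<open>The bound telescopes because \<open>k\<^bsup>-3/2\<^esup> \<le> 2 / sqrt (k - 1) - 2 / sqrt k\<close>; the constant \<open>3\<close>
  instead of \<open>2\<close> pays for the first term.\<close>

lemma sum_powr_three_halves_le:
  assumes "1 \<le> M" "M \<le> n"
  shows "(\<Sum>k=M..n. real k powr (-3/2)) \<le> 3 / sqrt (real M) - 2 / sqrt (real n)"
  using assms(2)
proof (induction rule: dec_induct)
  case base
  have "real M powr (-3/2) \<le> real M powr (-1/2)" using assms by (intro powr_mono) auto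
  also have "\<dots> = 1 / sqrt M" by (simp add: powr_minus powr_half_sqrt divide_simps)
  finally show ?case by (simp add: diff_divide_distrib[symmetric])
next
  case (step n)
  define a b where "a = sqrt (real n)" and "b = sqrt (real (Suc n))"
  have pos: "0 < a" "a \<le> b" using step assms by (auto simp: a_def b_def)
  have diff: "(b - a) * (b + a) = 1" by (simp add: a_def b_def algebra_simps flip:
      power2_eq_square)
  have "real (Suc n) powr (-3/2) = 1 / b ^ 3"
  proof -
    have "real (Suc n) powr (3/2) = (real (Suc n) powr (1/2)) powr 3" by (simp add: powr_powr)
    also have "\<dots> = b ^ 3" using pos by (simp add: powr_half_sqrt b_def powr_numeral)
    finally show ?thesis by (simp add: powr_minus divide_simps)
  qed
  also have "\<dots> \<le> 2 / (a * b * (b + a))"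
  proof -
    have "a * b * (b + a) \<le> b * b * (b + b)" using pos by (intro mult_mono) auto
    then have "a * b * (b + a) \<le> 2 * b ^ 3" by (simp add: power3_eq_cube)
    then show ?thesis using pos by (simp add: divide_simps mult.commute)
  qed
  also have "\<dots> = 2 * ((b - a) * (b + a)) / (a * b * (b + a))" by (simp add: diff)
  also have "\<dots> = 2 * (b - a) / (a * b)"
    using pos mult_divide_mult_cancel_right[of "b + a" "2 * (b - a)" "a * b"]
    by (simp add: mult.assoc)
  also have "\<dots> = 2 / a - 2 / b" using pos by (simp add: field_simps)
  finally have "real (Suc n) powr (-3/2) \<le> 2 / a - 2 / b" .
  then show ?case using step by (simp add: a_def b_def)
qed

text \<open>In \<open>k\<^bsup>p-2\<^esup> = k\<^bsup>p-1/2\<^esup> k\<^bsup>-3/2\<^esup>\<close> the first factor does not increase, because \<open>p \<le> 1/2\<close>; it is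
  largest at the lower end of the sum.\<close>

lemma sum_powr_tail_le:
  fixes p :: real
  assumes "1 \<le> M" "p \<le> 1 / 2"
  shows "(\<Sum>k=M..n. real k powr (p - 2)) \<le> 3 * real M powr (p - 1)"
proof (cases "M \<le> n")
  case True
  have "(\<Sum>k=M..n. real k powr (p - 2)) \<le> (\<Sum>k=M..n. real M powr (p - 1/2) * real k powr (-3/2))"
  proof (intro sum_mono)
    fix k assume k: "k \<in> {M..n}"
    have "real k powr (p - 2) = real k powr (p - 1/2) * real k powr (-3/2)"
      by (simp flip: powr_add)
    also have "\<dots> \<le> real M powr (p - 1/2) * real k powr (-3/2)"
      using k assms by (intro mult_right_mono powr_mono2') auto
    finally show "real k powr (p - 2) \<le> real M powr (p - 1/2) * real k powr (-3/2)" .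
  qed
  also have "\<dots> = real M powr (p - 1/2) * (\<Sum>k=M..n. real k powr (-3/2))"
    by (simp add: sum_distrib_left)
  also have "\<dots> \<le> real M powr (p - 1/2) * (3 * real M powr (-1/2))"
  proof (intro mult_left_mono)
    have "0 \<le> 2 / sqrt (real n)" by simp
    then have "(\<Sum>k=M..n. real k powr (-3/2)) \<le> 3 / sqrt (real M)"
      using sum_powr_three_halves_le[OF assms(1) True] by linarith
    also have "\<dots> = 3 * real M powr (-1/2)" by (simp add: powr_minus powr_half_sqrt divide_simps)
    finally show "(\<Sum>k=M..n. real k powr (-3/2)) \<le> 3 * real M powr (-1/2)" .
  qed simp
  also have "\<dots> = 3 * real M powr (p - 1)" by (simp flip: powr_add)
  finally show ?thesis .
qed simp

text \<open>The last term dominates: going down, the terms decay at least as fast as the powers of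
  \<open>2\<^bsup>-q\<^esup>\<close>.\<close>

lemma sum_doubling_powr_le:
  fixes b :: "nat \<Rightarrow> real"
  assumes "0 < q" and pos: "\<And>s. 0 < b s" and dbl: "\<And>s. 2 * b s \<le> b (Suc s)"
  shows "(\<Sum>s\<le>a. b s powr q) \<le> 1 / (1 - 2 powr (-q)) * b a powr q"
proof (induction a)
  case 0
  have "2 powr (-q) < (1::real)" using assms by (simp add: powr_less_one)
  then have "1 \<le> 1 / (1 - 2 powr (-q))" by simp
  then have "1 * b 0 powr q \<le> 1 / (1 - 2 powr (-q)) * b 0 powr q" by (intro mult_right_mono) auto
  then show ?case by simp
next
  case (Suc a)
  let ?C = "1 / (1 - 2 powr (-q))"
  have lt: "2 powr (-q) < (1::real)" using assms by (simp add: powr_less_one)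
  have "(2 * b a) powr q \<le> b (Suc a) powr q"
    using assms less_imp_le[OF pos[of a]] by (intro powr_mono2) auto
  then have step: "b a powr q \<le> 2 powr (-q) * b (Suc a) powr q"
    using pos[of a] by (simp add: powr_mult powr_minus divide_simps mult.commute)
  have "(\<Sum>s\<le>Suc a. b s powr q) \<le> ?C * b a powr q + b (Suc a) powr q"
    using Suc by simp
  also have "\<dots> \<le> ?C * (2 powr (-q) * b (Suc a) powr q) + b (Suc a) powr q"
    using lt step by (intro add_mono mult_left_mono) auto
  also have "\<dots> = (?C * 2 powr (-q) + 1) * b (Suc a) powr q" by (simp add: algebra_simps)
  also have "?C * 2 powr (-q) + 1 = ?C" using lt assms by (simp add: divide_simps)
  finally show ?case .
qed

text \<open>Summed over dyadic levels, the weak-type quantities of a nonnegative function add up to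
  its \<open>p\<close>-th power; this is the pointwise form of that statement.\<close>

lemma sum_levels_le:
  fixes \<delta> a p :: real
  assumes "0 < \<delta>" "0 \<le> a" "0 < p"
  shows "(\<Sum>j<J. (\<delta> * 2 ^ j) powr p * of_bool (\<delta> * 2 ^ j < a)) \<le> 1 / (1 - 2 powr (-p)) * a powr p"
proof (induction J)
  case 0
  have "2 powr (-p) < (1::real)" using assms by (simp add: powr_less_one)
  then show ?case by simp
next
  case (Suc J)
  show ?case
  proof (cases "\<delta> * 2 ^ J < a")
    case True
    have lt: "2 powr (-p) < (1::real)" using assms by (simp add: powr_less_one)
    have "(\<Sum>j<Suc J. (\<delta> * 2 ^ j) powr p * of_bool (\<delta> * 2 ^ j < a)) \<le> (\<Sum>j\<le>J. (\<delta> * 2 ^ j) powr p)"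
      unfolding lessThan_Suc_atMost by (intro sum_mono) auto
    also have "\<dots> \<le> 1 / (1 - 2 powr (-p)) * (\<delta> * 2 ^ J) powr p"
      using assms by (intro sum_doubling_powr_le) auto
    also have "\<dots> \<le> 1 / (1 - 2 powr (-p)) * a powr p"
      using True assms lt by (intro mult_left_mono powr_mono2) auto
    finally show ?thesis .
  next
    case False
    then show ?thesis using Suc by simp
  qed
qed

definition log_factor :: "real \<Rightarrow> nat \<Rightarrow> real" where
  "log_factor p n = ln (real n) ^ nat \<lfloor>1 / 2 + p\<rfloor>"

lemma log_factor_half: "log_factor (1/2) n = ln (real n)"
  by (simp add: log_factor_def)

lemma log_factor_less_half: "0 < p \<Longrightarrow> p < 1/2 \<Longrightarrow> log_factor p n = 1"
proof -
  assume "0 < p" "p < 1/2"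
  then have "\<lfloor>1 / 2 + p\<rfloor> = 0" by (simp add: floor_eq_iff)
  then show ?thesis by (simp add: log_factor_def)
qed

lemma log_factor_pos: "2 \<le> n \<Longrightarrow> 0 < log_factor p n"
  by (simp add: log_factor_def)

text \<open>The first of the two places where \<open>p = 1/2\<close> is critical: the exponent \<open>2p - 2\<close> is then
  \<open>-1\<close>, and the sum is harmonic instead of convergent.\<close>

lemma sum_weights_le:
  assumes "0 < p" "p \<le> 1 / 2"
  shows "\<exists>C>0. \<forall>n\<ge>2. (\<Sum>k=1..n. real k powr (2 * p - 2)) \<le> C * log_factor p n"
proof (cases "p = 1/2")
  case True
  have "(\<Sum>k=1..n. real k powr (2 * p - 2)) \<le> (1 + 1 / ln 2) * log_factor p n" if "2 \<le> n" for n
  proof -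
    have "(\<Sum>k=1..n. real k powr (2 * p - 2)) = harm n"
      unfolding harm_def True by (intro sum.cong) (auto simp: powr_minus)
    also have "harm n \<le> 1 + ln (real n)"
      using euler_mascheroni_sequence_decreasing[of 1 n] that by (simp add: harm_def)
    also have "1 + ln (real n) \<le> ln (real n) / ln 2 + ln (real n)"
      using that by (simp add: le_divide_eq)
    also have "\<dots> = (1 + 1 / ln 2) * log_factor p n" unfolding True log_factor_half
      by (simp add: algebra_simps)
    finally show ?thesis .
  qed
  moreover have "0 < 1 + 1 / ln (2::real)" by (simp add: add_pos_pos)
  ultimately show ?thesis by blast
next
  case False
  with assms have less: "p < 1/2" by simp
  then have summable: "summable (\<lambda>k. real k powr (2 * p - 2))"
    by (subst summable_real_powr_iff) simp
  have "(\<Sum>k=1..n. real k powr (2 * p - 2)) \<le> (\<Sum>k. real k powr (2 * p - 2)) + 1" for n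
    using sum_le_suminf[OF summable, of "{1..n}"] by simp
  moreover have "0 < (\<Sum>k. real k powr (2 * p - 2)) + 1"
    using suminf_nonneg[OF summable] by (simp add: add_nonneg_pos)
  ultimately show ?thesis using log_factor_less_half[OF assms(1) less]
    by (metis mult.right_neutral)
qed

section \<open>The number system and the Vilenkin functions\<close>

locale bounded_vilenkin =
  fixes m :: "nat \<Rightarrow> nat" and B :: nat
  assumes m_ge_2: "2 \<le> m k" and m_le: "m k \<le> B"
begin

abbreviation M :: "nat \<Rightarrow> nat" where "M \<equiv> vilenkin_base m"

lemma M_pos [simp]: "0 < M a"
  using vilenkin_base_gt[of m a] m_ge_2 by (metis gr0I not_less_zero)

lemma B_ge_2: "2 \<le> B" using m_ge_2[of 0] m_le[of 0] by simp

lemma M_dvd: "i \<le> j \<Longrightarrow> M i dvd M j"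
  by (induction rule: dec_induct) auto

lemma M_mono: "i \<le> j \<Longrightarrow> M i \<le> M j"
  by (rule dvd_imp_le[OF M_dvd]) simp_all

lemma M_growth: "i \<le> j \<Longrightarrow> 2 ^ (j - i) * M i \<le> M j"
proof (induction rule: dec_induct)
  case (step n)
  have "2 ^ (Suc n - i) * M i = 2 * (2 ^ (n - i) * M i)"
    using step(1) by (simp add: Suc_diff_le)
  also have "\<dots> \<le> m n * M n"
    using step m_ge_2[of n] by (intro mult_mono) auto
  finally show ?case by simp
qed simp

lemma M_ge_power: "2 ^ a \<le> M a"
  using M_growth[of 0 a] by simp

lemma base_bracket:
  assumes "1 \<le> k"
  obtains A where "M A \<le> k" "k < M (Suc A)"
proof -
  have "\<exists>a. k < M a" using vilenkin_base_gt[of m k] m_ge_2 by blast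
  then have *: "k < M (LEAST a. k < M a)" by (rule LeastI_ex)
  obtain A where A: "(LEAST a. k < M a) = Suc A"
    using * assms by (cases "LEAST a. k < M a") auto
  then have "\<not> k < M A" by (metis lessI not_less_Least)
  then show thesis using that[of A] * A by simp
qed

lemma digit_of_block:
  assumes "k < a"
  shows "vilenkin_digit m (r * M a + i) k = vilenkin_digit m i k"
proof -
  have dig: "vilenkin_digit m n k = n mod M (Suc k) div M k" for n
  proof -
    have "n mod (M k * m k) = M k * (n div M k mod m k) + n mod M k" by (rule mod_mult2_eq)
    then have "n mod (M k * m k) div M k = n div M k mod m k"
      using M_pos[of k] by (simp add: div_add1_eq)
    then show ?thesis by (simp add: vilenkin_digit_def mult.commute)
  qed
  have "M (Suc k) dvd r * M a" using assms M_dvd[of "Suc k" a] by simp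
  then have "(r * M a + i) mod M (Suc k) = i mod M (Suc k)"
    by (metis add_0 dvd_imp_mod_0 mod_add_left_eq)
  then show ?thesis by (simp only: dig)
qed

lemma vilenkin_fun_prod:
  assumes "n < M a"
  shows "vilenkin_fun m n x = (\<Prod>k<a. rademacher m k x ^ vilenkin_digit m n k)"
  unfolding vilenkin_fun_def
proof (intro prod.mono_neutral_left)
  have "vilenkin_digit m n k = 0" if "a \<le> k" for k
    using assms M_mono[OF that] by (simp add: vilenkin_digit_def)
  then show "{k. vilenkin_digit m n k \<noteq> 0} \<subseteq> {..<a}"
    by (metis (mono_tags) lessThan_iff mem_Collect_eq not_le subsetI)
qed auto

text \<open>The self-similarity behind all kernel recursions: the functions with index in the block
  that starts at \<open>r M\<^sub>a\<close> are those of the block at \<open>0\<close>, multiplied by a power of a single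
  character.\<close>

lemma vilenkin_fun_block:
  assumes "r < m a" and "i < M a"
  shows "vilenkin_fun m (r * M a + i) x = rademacher m a x ^ r * vilenkin_fun m i x"
proof -
  have "r * M a + i < Suc r * M a" using assms(2) by simp
  also have "\<dots> \<le> M (Suc a)" unfolding vilenkin_base_Suc using assms(1)
    by (intro mult_right_mono) auto
  finally have less: "r * M a + i < M (Suc a)" .
  have "(r * M a + i) div M a = r" using assms(2) by simp
  then have "vilenkin_digit m (r * M a + i) a = r" using assms(1) unfolding vilenkin_digit_def
    by simp
  then show ?thesis
    unfolding vilenkin_fun_prod[OF less] vilenkin_fun_prod[OF assms(2)]
    by (simp add: digit_of_block mult.commute)
qed

lemma norm_rademacher [simp]: "cmod (rademacher m k x) = 1"
proof -
  have "rademacher m k x = exp (\<i> * of_real (2 * pi * x k / m k))"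
    by (simp add: rademacher_def mult_ac)
  then show ?thesis by (simp only: norm_exp_i_times)
qed

lemma vilenkin_fun_0 [simp]: "vilenkin_fun m 0 x = 1"
  using vilenkin_fun_prod[of 0 0 x] by simp

definition agree :: "nat \<Rightarrow> (nat \<Rightarrow> nat) \<Rightarrow> (nat \<Rightarrow> nat) \<Rightarrow> bool" where
  "agree a x t \<longleftrightarrow> (\<forall>i<a. x i = t i)"

lemma vilenkin_fun_cong:
  assumes "j < M N" "agree N t u"
  shows "vilenkin_fun m j t = vilenkin_fun m j u"
  using assms(2) unfolding vilenkin_fun_prod[OF assms(1)]
  by (intro prod.cong) (auto simp: agree_def rademacher_def)

section \<open>Dirichlet and Fejer kernels\<close>

text \<open>The kernels are functions of two points instead of functions of the difference \<open>x - t\<close> in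
  the group. This avoids translations: the difference enters only through the question in which
  coordinates the two points agree. Note that \<open>fejer_sum n\<close> is \<open>n K\<^sub>n\<close>, not \<open>K\<^sub>n\<close>.\<close>

definition char_prod :: "nat \<Rightarrow> (nat \<Rightarrow> nat) \<Rightarrow> (nat \<Rightarrow> nat) \<Rightarrow> complex" where
  "char_prod j x t = vilenkin_fun m j x * cnj (vilenkin_fun m j t)"

definition dirichlet :: "nat \<Rightarrow> (nat \<Rightarrow> nat) \<Rightarrow> (nat \<Rightarrow> nat) \<Rightarrow> complex" where
  "dirichlet n x t = (\<Sum>j<n. char_prod j x t)"

definition fejer_sum :: "nat \<Rightarrow> (nat \<Rightarrow> nat) \<Rightarrow> (nat \<Rightarrow> nat) \<Rightarrow> complex" where
  "fejer_sum n x t = (\<Sum>k=1..n. dirichlet k x t)"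

definition ratio :: "nat \<Rightarrow> (nat \<Rightarrow> nat) \<Rightarrow> (nat \<Rightarrow> nat) \<Rightarrow> complex" where
  "ratio a x t = rademacher m a x * cnj (rademacher m a t)"

text \<open>If \<open>s \<ge> a\<close>, this is agreement in all of the first \<open>a\<close> coordinates.\<close>

definition agree_but :: "nat \<Rightarrow> nat \<Rightarrow> (nat \<Rightarrow> nat) \<Rightarrow> (nat \<Rightarrow> nat) \<Rightarrow> bool" where
  "agree_but s a x t \<longleftrightarrow> (\<forall>i<a. i \<noteq> s \<longrightarrow> x i = t i)"

text \<open>A pointwise bound, up to a constant factor, for \<open>fejer_sum (M a)\<close>. The term \<open>s = a\<close> is the
  peak \<open>M\<^sub>a\<^sup>2\<close> on the interval of level \<open>a\<close>; the terms \<open>s < a\<close> account for the ridges on which one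
  earlier coordinate is free.\<close>

definition majorant :: "nat \<Rightarrow> (nat \<Rightarrow> nat) \<Rightarrow> (nat \<Rightarrow> nat) \<Rightarrow> real" where
  "majorant a x t = (\<Sum>s\<le>a. real (M a) * real (M s) * of_bool (agree_but s a x t))"

lemma majorant_nonneg: "0 \<le> majorant a x t"
  unfolding majorant_def by (intro sum_nonneg) auto

lemma norm_ratio [simp]: "cmod (ratio a x t) = 1"
  by (simp add: ratio_def norm_mult)

lemma ratio_power: "ratio a x t ^ m a = 1"
proof -
  have "rademacher m a x ^ m a = 1" for x
  proof -
    have "rademacher m a x ^ m a = exp (of_nat (m a) * (2 * of_real pi * \<i>
        * of_nat (x a) / of_nat (m a)))"
      by (simp only: rademacher_def exp_of_nat_mult)
    also have "of_nat (m a) * (2 * of_real pi * \<i> * of_nat (x a) / of_nat (m a))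
        = 2 * of_real pi * \<i> * of_nat (x a)"
      using m_ge_2[of a] by simp
    also have "exp \<dots> = 1" unfolding exp_eq_1 by (simp add: exI[of _ "int (x a)"])
    finally show ?thesis .
  qed
  then show ?thesis by (simp add: ratio_def power_mult_distrib flip: complex_cnj_power)
qed

lemma ratio_eq_1_iff:
  assumes "x a < m a" and "t a < m a"
  shows "ratio a x t = 1 \<longleftrightarrow> x a = t a"
proof -
  have "ratio a x t = exp (2 * of_real pi * \<i> * of_int (int (x a) - int (t a)) / of_nat (m a))"
    unfolding ratio_def rademacher_def exp_cnj
    by (simp add: diff_divide_distrib right_diff_distrib exp_diff exp_minus field_simps)
  also have "\<dots> = exp (2 * of_real pi * \<i> * of_int (int (x a) - int (t a)) / of_int (int (m a)))"
    by simp
  also have "\<dots> = 1 \<longleftrightarrow> (int (m a) dvd (int (x a) - int (t a)))"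
  proof
    assume "exp (2 * of_real pi * \<i> * of_int (int (x a) - int (t a)) / of_int (int (m a))) = 1"
    then obtain n :: int where n: "2 * pi * real_of_int (int (x a) - int (t a)) / real (m a)
        = real_of_int (2 * n) * pi"
      unfolding exp_eq_1 by auto
    then have "(2 * pi) * real_of_int (int (x a) - int (t a))
        = (2 * pi) * real_of_int (int (m a) * n)"
      using m_ge_2[of a] by (simp add: field_simps)
    then have "real_of_int (int (x a) - int (t a)) = real_of_int (int (m a) * n)"
      by (subst (asm) mult_left_cancel) simp_all
    then have "int (x a) - int (t a) = int (m a) * n" by (simp only: of_int_eq_iff)
    then show "int (m a) dvd (int (x a) - int (t a))" by simp
  next
    assume "int (m a) dvd (int (x a) - int (t a))"
    then obtain n where n: "int (x a) - int (t a) = int (m a) * n" by (elim dvdE)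
    show "exp (2 * of_real pi * \<i> * of_int (int (x a) - int (t a)) / of_int (int (m a))) = 1"
      unfolding n exp_eq_1 using m_ge_2[of a] by auto
  qed
  also have "\<dots> \<longleftrightarrow> x a = t a"
  proof
    assume "int (m a) dvd (int (x a) - int (t a))"
    then have "int (x a) mod int (m a) = int (t a) mod int (m a)" by (simp add: mod_eq_dvd_iff)
    then show "x a = t a" using assms by simp
  qed simp
  finally show ?thesis .
qed

text \<open>Orthogonality of the characters of the cyclic group of order \<open>m a\<close>.\<close>

lemma ratio_geometric_sum:
  assumes "x \<in> vilenkin_group m" and "t \<in> vilenkin_group m"
  shows "(\<Sum>i<m a. ratio a x t ^ i) = of_nat (m a) * of_bool (x a = t a)"
proof (cases "x a = t a")
  case True
  then have "ratio a x t = 1" using ratio_eq_1_iff assms by (simp add: vilenkin_group_def)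
  then show ?thesis using True by simp
next
  case False
  then have "ratio a x t \<noteq> 1" using ratio_eq_1_iff assms by (simp add: vilenkin_group_def)
  then show ?thesis using False by (simp add: geometric_sum ratio_power)
qed

lemma char_prod_block:
  assumes "r < m a" and "i < M a"
  shows "char_prod (r * M a + i) x t = ratio a x t ^ r * char_prod i x t"
  by (simp add: char_prod_def vilenkin_fun_block[OF assms] ratio_def power_mult_distrib)

lemma sum_lessThan_add:
  fixes f :: "nat \<Rightarrow> 'b :: comm_monoid_add"
  shows "sum f {..<n + k} = sum f {..<n} + (\<Sum>i<k. f (n + i))"
  by (induction k) (simp_all add: add.assoc)

lemma dirichlet_add_block:
  assumes "r < m a" and "j \<le> M a"
  shows "dirichlet (r * M a + j) x t = dirichlet (r * M a) x t + ratio a x t ^ r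
      * dirichlet j x t"
  unfolding dirichlet_def sum_lessThan_add sum_distrib_left
  using assms by (intro arg_cong2[of _ _ _ _ "(+)"] refl sum.cong) (auto intro!: char_prod_block)

lemma dirichlet_multiple:
  assumes "r \<le> m a"
  shows "dirichlet (r * M a) x t = (\<Sum>i<r. ratio a x t ^ i) * dirichlet (M a) x t"
  using assms
proof (induction r)
  case (Suc r)
  have "dirichlet (Suc r * M a) x t = dirichlet (r * M a + M a) x t" by (simp add: add.commute)
  also have "\<dots> = dirichlet (r * M a) x t + ratio a x t ^ r * dirichlet (M a) x t"
    using Suc by (intro dirichlet_add_block) auto
  finally show ?case using Suc by (simp add: algebra_simps)
qed (simp add: dirichlet_def)

text \<open>By \<open>dirichlet_multiple\<close> with \<open>r = m a\<close>, passing from \<open>M\<^sub>a\<close> to \<open>M\<^sub>a\<^sub>+\<^sub>1\<close> multiplies the kernel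
  by a full geometric sum, which tests equality of one more coordinate.\<close>

lemma dirichlet_base:
  assumes "x \<in> vilenkin_group m" and "t \<in> vilenkin_group m"
  shows "dirichlet (M a) x t = of_nat (M a) * of_bool (agree a x t)"
proof (induction a)
  case 0
  then show ?case by (simp add: dirichlet_def char_prod_def agree_def)
next
  case (Suc a)
  have "dirichlet (M (Suc a)) x t = (of_nat (m a) * of_bool (x a
      = t a)) * (of_nat (M a) * of_bool (agree a x t))"
    using dirichlet_multiple[of "m a" a x t] Suc ratio_geometric_sum[OF assms, of a] by simp
  then show ?case by (auto simp: agree_def less_Suc_eq)
qed

lemma norm_dirichlet_multiple:
  assumes "x \<in> vilenkin_group m" and "t \<in> vilenkin_group m" and "r \<le> m a"
  shows "cmod (dirichlet (r * M a) x t) \<le> real B * (real (M a) * of_bool (agree a x t))"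
proof -
  have "cmod (\<Sum>i<r. ratio a x t ^ i) \<le> (\<Sum>i<r. 1)"
    by (intro sum_norm_le) (simp add: norm_power)
  also have "\<dots> \<le> real B" using assms(3) m_le[of a] by simp
  finally have geom: "cmod (\<Sum>i<r. ratio a x t ^ i) \<le> real B" .
  have "cmod (dirichlet (r * M a) x t)
      = cmod (\<Sum>i<r. ratio a x t ^ i) * (real (M a) * of_bool (agree a x t))"
    unfolding dirichlet_multiple[OF assms(3)] dirichlet_base[OF assms(1,2)]
    by (simp add: norm_mult)
  also have "\<dots> \<le> real B * (real (M a) * of_bool (agree a x t))"
    by (rule mult_right_mono[OF geom]) simp
  finally show ?thesis .
qed

lemma fejer_sum_add_block:
  assumes "r < m a" and "j \<le> M a"
  shows "fejer_sum (r * M a + j) x t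
    = fejer_sum (r * M a) x t + of_nat j * dirichlet (r * M a) x t + ratio a x t ^ r
        * fejer_sum j x t"
  using assms(2)
proof (induction j)
  case (Suc j)
  have "fejer_sum (r * M a + Suc j) x t
      = fejer_sum (r * M a + j) x t + dirichlet (r * M a + Suc j) x t"
    by (simp add: fejer_sum_def)
  also have "dirichlet (r * M a + Suc j) x t
      = dirichlet (r * M a) x t + ratio a x t ^ r * dirichlet (Suc j) x t"
    using Suc.prems assms(1) by (intro dirichlet_add_block)
  finally show ?case using Suc by (simp add: fejer_sum_def algebra_simps)
qed (simp add: fejer_sum_def)

lemma fejer_sum_multiple:
  assumes "r \<le> m a"
  shows "fejer_sum (r * M a) x t
    = of_nat (M a) * (\<Sum>i<r. dirichlet (i * M a) x t) + (\<Sum>i<r. ratio a x t ^ i)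
        * fejer_sum (M a) x t"
  using assms
proof (induction r)
  case (Suc r)
  have "fejer_sum (Suc r * M a) x t = fejer_sum (r * M a + M a) x t" by (simp add: add.commute)
  also have "\<dots> = fejer_sum (r * M a) x t + of_nat (M a) * dirichlet (r * M a) x t
      + ratio a x t ^ r * fejer_sum (M a) x t"
    using Suc.prems by (intro fejer_sum_add_block) auto
  finally show ?case using Suc by (simp add: algebra_simps)
qed (simp add: fejer_sum_def)

lemma norm_sum_dirichlet_multiples:
  assumes "x \<in> vilenkin_group m" and "t \<in> vilenkin_group m" and "r \<le> m a"
  shows "cmod (of_nat (M a) * (\<Sum>i<r. dirichlet (i * M a) x t))
    \<le> real B ^ 2 * (real (M a) ^ 2 * of_bool (agree a x t))"
proof -
  have "cmod (\<Sum>i<r. dirichlet (i * M a) x t)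
      \<le> (\<Sum>i<r. real B * (real (M a) * of_bool (agree a x t)))"
    using assms by (intro sum_norm_le norm_dirichlet_multiple) auto
  also have "\<dots> = real r * (real B * (real (M a) * of_bool (agree a x t)))" by simp
  also have "\<dots> \<le> real B * (real B * (real (M a) * of_bool (agree a x t)))"
    using assms(3) m_le[of a] by (intro mult_right_mono) auto
  finally have "cmod (\<Sum>i<r. dirichlet (i * M a) x t)
      \<le> real B * (real B * (real (M a) * of_bool (agree a x t)))" .
  then have "real (M a) * cmod (\<Sum>i<r. dirichlet (i * M a) x t)
      \<le> real (M a) * (real B * (real B * (real (M a) * of_bool (agree a x t))))"
    by (intro mult_left_mono) auto
  then show ?thesis by (simp add: norm_mult power2_eq_square mult_ac)
qed

lemma agree_le_majorant: "real (M a) ^ 2 * of_bool (agree a x t) \<le> majorant a x t"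
proof -
  have "real (M a) ^ 2 * of_bool (agree a x t)
      = real (M a) * real (M a) * of_bool (agree_but a a x t)"
    by (auto simp: power2_eq_square agree_def agree_but_def)
  also have "\<dots> \<le> majorant a x t"
    unfolding majorant_def by (intro member_le_sum[of a "{..a}" "\<lambda>s. real (M a) * real (M s)
        * of_bool (agree_but s a x t)"]) auto
  finally show ?thesis .
qed

text \<open>The recursion that \<open>majorant\<close> is designed to satisfy. If the points agree in coordinate
  \<open>a\<close>, all the sets are unchanged and the weights are multiplied by \<open>m a\<close>. Otherwise the only
  contribution comes from points that agree before coordinate \<open>a\<close>, and this is the new ridge
  \<open>s = a\<close>.\<close>

lemma majorant_Suc:
  "real (M a) ^ 2 * of_bool (agree a x t) + real (m a) * of_bool (x a = t a) * majorant a x t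
    \<le> majorant (Suc a) x t"
proof (cases "x a = t a")
  case True
  then have ag: "agree_but s (Suc a) x t = agree_but s a x t" for s
    by (auto simp: agree_but_def less_Suc_eq)
  have ag': "agree_but (Suc a) a x t = agree a x t" by (auto simp: agree_but_def agree_def)
  have "majorant (Suc a) x t = real (m a) * majorant a x t + real (M (Suc a)) ^ 2
      * of_bool (agree a x t)"
    unfolding majorant_def by (simp add: ag ag' sum_distrib_left mult_ac power2_eq_square)
  moreover have "real (M a) ^ 2 * of_bool (agree a x t)
      \<le> real (M (Suc a)) ^ 2 * of_bool (agree a x t)"
    using M_mono[of a "Suc a"] by (intro mult_right_mono power_mono) auto
  ultimately show ?thesis using True by simp
next
  case False
  have "real (M a) ^ 2 * of_bool (agree a x t)
      = real (M a) * real (M a) * of_bool (agree_but a (Suc a) x t)"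
    by (auto simp: power2_eq_square agree_def agree_but_def less_Suc_eq)
  also have "\<dots> \<le> real (M (Suc a)) * real (M a) * of_bool (agree_but a (Suc a) x t)"
    using M_mono[of a "Suc a"] by (intro mult_right_mono) auto
  also have "\<dots> \<le> majorant (Suc a) x t"
    unfolding majorant_def
    by (intro member_le_sum[of a "{..Suc a}" "\<lambda>s. real (M (Suc a)) * real (M s)
        * of_bool (agree_but s (Suc a) x t)"]) auto
  finally show ?thesis using False by simp
qed

text \<open>Induction on the level: \<open>fejer_sum_multiple\<close> expresses the kernel of order \<open>M\<^sub>a\<^sub>+\<^sub>1\<close> by
  Dirichlet kernels concentrated on one interval and by the kernel of order \<open>M\<^sub>a\<close>, multiplied by
  a full geometric sum.\<close>

lemma norm_fejer_sum_base:
  assumes "x \<in> vilenkin_group m" and "t \<in> vilenkin_group m"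
  shows "cmod (fejer_sum (M a) x t) \<le> real B ^ 2 * majorant a x t"
proof (induction a)
  case 0
  have "1 \<le> real B ^ 2" using B_ge_2 by simp
  then show ?case by (simp add: fejer_sum_def dirichlet_def char_prod_def majorant_def
      agree_but_def)
next
  case (Suc a)
  have "cmod (fejer_sum (M (Suc a)) x t)
     \<le> cmod (of_nat (M a) * (\<Sum>i<m a. dirichlet (i * M a) x t))
       + cmod (of_nat (m a) * of_bool (x a = t a) * fejer_sum (M a) x t)"
    using fejer_sum_multiple[of "m a" a x t]
    by (simp add: ratio_geometric_sum[OF assms] norm_triangle_ineq)
  also have "\<dots> \<le> real B ^ 2 * (real (M a) ^ 2 * of_bool (agree a x t))
      + real (m a) * of_bool (x a = t a) * (real B ^ 2 * majorant a x t)"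
  proof (intro add_mono norm_sum_dirichlet_multiples assms order.refl)
    show "cmod (of_nat (m a) * of_bool (x a = t a) * fejer_sum (M a) x t)
      \<le> real (m a) * of_bool (x a = t a) * (real B ^ 2 * majorant a x t)"
      using Suc by (auto simp: norm_mult intro!: mult_left_mono)
  qed
  also have "\<dots> = real B ^ 2 * (real (M a) ^ 2 * of_bool (agree a x t) + real (m a)
      * of_bool (x a = t a) * majorant a x t)"
    by (simp add: algebra_simps)
  also have "\<dots> \<le> real B ^ 2 * majorant (Suc a) x t"
    by (intro mult_left_mono majorant_Suc) auto
  finally show ?case .
qed

text \<open>Splitting off the leading digit of \<open>n\<close> leaves the kernel of the remainder, which has lower
  order; every digit costs one multiple of the majorant of its level.\<close>

lemma norm_fejer_sum:
  assumes "x \<in> vilenkin_group m" and "t \<in> vilenkin_group m" and "n < M a"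
  shows "cmod (fejer_sum n x t) \<le> 3 * real B ^ 3 * (\<Sum>b<a. majorant b x t)"
  using assms(3)
proof (induction a arbitrary: n)
  case 0
  then show ?case by (simp add: fejer_sum_def)
next
  case (Suc a)
  define r j where "r = n div M a" and "j = n mod M a"
  have n: "n = r * M a + j" unfolding r_def j_def by (rule div_mult_mod_eq[symmetric])
  have j: "j < M a" by (simp add: j_def)
  have r: "r < m a" unfolding r_def using Suc.prems by (simp add: less_mult_imp_div_less)
  let ?W = "majorant a x t"
  have W: "real (M a) ^ 2 * of_bool (agree a x t) \<le> ?W" by (rule agree_le_majorant)
  have "cmod (fejer_sum (r * M a) x t) \<le> real B ^ 2 * ?W + real B * (real B ^ 2 * ?W)"
  proof -
    have "cmod (\<Sum>i<r. ratio a x t ^ i) \<le> (\<Sum>i<r. 1)"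
      by (intro sum_norm_le) (simp add: norm_power)
    also have "\<dots> \<le> B" using r m_le[of a] by simp
    finally have "cmod ((\<Sum>i<r. ratio a x t ^ i) * fejer_sum (M a) x t)
        \<le> real B * (real B ^ 2 * ?W)"
      unfolding norm_mult by (intro mult_mono norm_fejer_sum_base assms) auto
    moreover have "cmod (of_nat (M a) * (\<Sum>i<r. dirichlet (i * M a) x t)) \<le> real B ^ 2 * ?W"
      using norm_sum_dirichlet_multiples[OF assms(1,2), of r a] r W
      by (meson less_imp_le mult_left_mono order_trans zero_le_power2)
    ultimately show ?thesis
      using r by (subst fejer_sum_multiple) (auto intro: norm_triangle_mono)
  qed
  moreover have "cmod (of_nat j * dirichlet (r * M a) x t) \<le> real B * ?W"
  proof -
    have "cmod (of_nat j * dirichlet (r * M a) x t)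
        \<le> real (M a) * (real B * (real (M a) * of_bool (agree a x t)))"
      unfolding norm_mult using j r by (intro mult_mono norm_dirichlet_multiple assms) auto
    also have "\<dots> = real B * (real (M a) ^ 2 * of_bool (agree a x t))"
      by (simp add: power2_eq_square mult_ac)
    also have "\<dots> \<le> B * ?W" using W by (intro mult_left_mono) auto
    finally show ?thesis .
  qed
  moreover have "cmod (ratio a x t ^ r * fejer_sum j x t)
      \<le> 3 * real B ^ 3 * (\<Sum>b<a. majorant b x t)"
    using Suc.IH[OF j] by (simp add: norm_mult norm_power)
  ultimately have "cmod (fejer_sum n x t)
      \<le> (real B ^ 2 * ?W + real B * (real B ^ 2 * ?W)) + real B * ?W + 3 * real B ^ 3
          * (\<Sum>b<a. majorant b x t)"
    unfolding n using r j by (subst fejer_sum_add_block) (auto intro!: norm_triangle_mono)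
  also have "\<dots> \<le> 3 * real B ^ 3 * ?W + 3 * real B ^ 3 * (\<Sum>b<a. majorant b x t)"
  proof -
    have "real B ^ 2 \<le> real B ^ 3" "real B \<le> real B ^ 3"
      using B_ge_2 power_increasing[of 2 3 "real B"] power_increasing[of 1 3 "real B"] by auto
    then have "real B ^ 2 * ?W \<le> real B ^ 3 * ?W" "real B * ?W \<le> real B ^ 3 * ?W"
      using majorant_nonneg by (auto intro: mult_right_mono)
    moreover have "real B * (real B ^ 2 * ?W) = real B ^ 3 * ?W"
      by (simp add: power3_eq_cube power2_eq_square mult_ac)
    ultimately show ?thesis by linarith
  qed
  finally show ?case by (simp add: algebra_simps)
qed

section \<open>The finite quotients of the Vilenkin group\<close>

lemma M_nonzero [simp]: "M a \<noteq> 0"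
  using M_pos[of a] by simp

lemma m_pos [simp]: "0 < m k" using m_ge_2[of k] by simp

lemma sum_base_powr_le:
  assumes "0 < q"
  shows "(\<Sum>s\<le>a. real (M s) powr q) \<le> 1 / (1 - 2 powr (-q)) * real (M a) powr q"
proof (rule sum_doubling_powr_le[OF assms])
  show "2 * real (M s) \<le> real (M (Suc s))" for s using m_ge_2[of s] by simp
qed simp

lemma sum_base_le: "(\<Sum>s\<le>a. real (M s)) \<le> 2 * real (M a)"
  using sum_base_powr_le[of 1 a] by (simp add: powr_minus)

text \<open>The second place where \<open>p = 1/2\<close> is critical: every term is then \<open>1\<close>, and the number of
  levels up to \<open>n\<close> is of the order of \<open>ln n\<close> because \<open>M\<^sub>N \<ge> 2\<^sup>N\<close>.\<close>

lemma sum_base_powr_log_le: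
  assumes "0 < p" "p \<le> 1 / 2"
  shows "\<exists>C>0. \<forall>n\<ge>2. \<forall>N. M N \<le> n \<longrightarrow> (\<Sum>a\<le>N. real (M a) powr (2 * p - 1)) \<le> C * log_factor p n"
proof (cases "p = 1/2")
  case True
  have "(\<Sum>a\<le>N. real (M a) powr (2 * p - 1)) \<le> (2 / ln 2) * log_factor p n" if "2 \<le> n" "M N
      \<le> n" for n N
  proof -
    have "(\<Sum>a\<le>N. real (M a) powr (2 * p - 1)) = N + 1" unfolding True by simp
    moreover have "real N * ln 2 \<le> ln n"
    proof -
      have "(2::nat) ^ N \<le> n" using M_ge_power[of N] that by linarith
      then have "(2::real) ^ N \<le> real n" by (metis of_nat_le_iff of_nat_numeral of_nat_power)
      then have "ln ((2::real) ^ N) \<le> ln n" using that by (subst ln_le_cancel_iff) auto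
      then show ?thesis by (simp add: ln_realpow)
    qed
    moreover have "ln 2 \<le> ln (real n)" using that by simp
    ultimately show ?thesis unfolding True log_factor_half by (simp add: field_simps)
  qed
  moreover have "0 < 2 / ln (2::real)" by simp
  ultimately show ?thesis by blast
next
  case False
  with assms have less: "p < 1/2" by simp
  define r :: real where "r = 2 powr (2 * p - 1)"
  have r: "0 < r" "r < 1" using less by (auto simp: r_def powr_less_one)
  have "(\<Sum>a\<le>N. real (M a) powr (2 * p - 1)) \<le> 1 / (1 - r)" for N
  proof -
    have "(\<Sum>a\<le>N. real (M a) powr (2 * p - 1)) \<le> (\<Sum>a\<le>N. r ^ a)"
    proof (intro sum_mono)
      fix a
      have "2 ^ a \<le> real (M a)" using M_ge_power[of a]
        by (metis of_nat_le_iff of_nat_numeral of_nat_power)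
      then have "real (M a) powr (2 * p - 1) \<le> (2 ^ a) powr (2 * p - 1)"
        using less by (intro powr_mono2') auto
      also have "\<dots> = r ^ a" by (simp add: r_def powr_powr mult.commute flip: powr_realpow)
      finally show "real (M a) powr (2 * p - 1) \<le> r ^ a" .
    qed
    also have "\<dots> \<le> (\<Sum>a. r ^ a)" using r by (intro sum_le_suminf summable_geometric) auto
    also have "\<dots> = 1 / (1 - r)" using r by (intro suminf_geometric) auto
    finally show ?thesis .
  qed
  moreover have "0 < 1 / (1 - r)" using r by simp
  ultimately show ?thesis using log_factor_less_half[OF assms(1) less]
    by (metis mult.right_neutral)
qed

lemma agree_refl [simp]: "agree i x x" by (simp add: agree_def)

lemma agree_sym: "agree i x y \<Longrightarrow> agree i y x" by (simp add: agree_def)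

lemma agree_trans: "agree i x y \<Longrightarrow> agree i y z \<Longrightarrow> agree i x z" by (simp add: agree_def)

lemma agree_mono: "agree j x y \<Longrightarrow> i \<le> j \<Longrightarrow> agree i x y" by (simp add: agree_def)

lemma agree_trans_Suc: "agree (Suc i) x y \<Longrightarrow> agree i y z \<Longrightarrow> agree i x z"
  by (simp add: agree_def)

text \<open>The quotient of the Vilenkin group by the interval of level \<open>L\<close> at \<open>0\<close>, represented by the
  points whose coordinates from \<open>L\<close> on are \<open>0\<close>. With these representatives the quotient is a
  subset of the group, and the quotients of different levels are nested.\<close>

definition trunc_group :: "nat \<Rightarrow> (nat \<Rightarrow> nat) set" where
  "trunc_group L = PiE_dflt {..<L} 0 (\<lambda>i. {..<m i})"

definition cell :: "nat \<Rightarrow> nat \<Rightarrow> (nat \<Rightarrow> nat) \<Rightarrow> (nat \<Rightarrow> nat) set" where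
  "cell L a u = {x \<in> trunc_group L. agree a x u}"

lemma finite_trunc_group [simp]: "finite (trunc_group L)"
  unfolding trunc_group_def by (intro finite_PiE_dflt) auto

lemma finite_cell [simp]: "finite (cell L a u)"
  unfolding cell_def by simp

lemma trunc_group_subset: "trunc_group L \<subseteq> vilenkin_group m"
proof
  fix x assume "x \<in> trunc_group L"
  then have "x k < m k" for k by (cases "k < L") (auto simp: trunc_group_def PiE_dflt_def)
  then show "x \<in> vilenkin_group m" by (simp add: vilenkin_group_def)
qed

lemma trunc_group_mono: "i \<le> L \<Longrightarrow> trunc_group i \<subseteq> trunc_group L"
proof
  fix x assume "i \<le> L" "x \<in> trunc_group i"
  then have "x k \<in> {..<m k}" "L \<le> k \<Longrightarrow> x k = 0" for k
    using trunc_group_subset[of i] by (auto simp: trunc_group_def PiE_dflt_def vilenkin_group_def)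
  then show "x \<in> trunc_group L" by (auto simp: trunc_group_def PiE_dflt_def)
qed

lemma card_fixed_coordinates:
  assumes "u \<in> vilenkin_group m" "S \<subseteq> {..<L}"
  shows "card {x \<in> trunc_group L. \<forall>i\<in>S. x i = u i} * (\<Prod>i\<in>S. m i) = M L"
proof -
  have "{x \<in> trunc_group L. \<forall>i\<in>S. x i = u i} = PiE_dflt {..<L} 0 (\<lambda>i.
      if i \<in> S then {u i} else {..<m i})"
    using assms by (auto simp: trunc_group_def PiE_dflt_def vilenkin_group_def split: if_splits)
  then have "card {x \<in> trunc_group L. \<forall>i\<in>S. x i = u i} = (\<Prod>i<L. if i \<in> S then 1 else m i)"
    by (simp add: card_PiE_dflt if_distrib[of card] cong: if_cong)
  moreover have "(\<Prod>i\<in>S. m i) = (\<Prod>i<L. if i \<in> S then m i else 1)"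
    using assms(2) by (intro prod.mono_neutral_cong_left) auto
  ultimately show ?thesis
    by (auto simp: vilenkin_base_def prod.distrib[symmetric] intro!: prod.cong)
qed

lemma card_trunc_group: "card (trunc_group L) = M L"
  using card_fixed_coordinates[of "\<lambda>_. 0" "{}" L] by (simp add: vilenkin_group_def)

lemma card_cell:
  assumes "u \<in> vilenkin_group m" "a \<le> L"
  shows "real (card (cell L a u)) = real (M L) / real (M a)"
proof -
  have "{x \<in> trunc_group L. \<forall>i\<in>{..<a}. x i = u i} = cell L a u"
    by (auto simp: cell_def agree_def)
  then have "card (cell L a u) * M a = M L"
    using card_fixed_coordinates[of u "{..<a}" L] assms by (simp add: vilenkin_base_def)
  then have "real (card (cell L a u)) * real (M a) = real (M L)" by (metis of_nat_mult)
  then show ?thesis by (simp add: field_simps)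
qed

text \<open>Leaving one coordinate free multiplies the number of points by at most \<open>B\<close>.\<close>

lemma card_agree_but_le:
  assumes "u \<in> vilenkin_group m" "a \<le> L"
  shows "real (card {x \<in> trunc_group L. agree_but s a x u}) \<le> real B * real (M L) / real (M a)"
proof -
  let ?S = "{..<a} - {s}"
  have eq: "{x \<in> trunc_group L. \<forall>i\<in>?S. x i = u i} = {x \<in> trunc_group L. agree_but s a x u}"
    by (auto simp: agree_but_def)
  have "M a \<le> B * (\<Prod>i\<in>?S. m i)"
  proof (cases "s < a")
    case True
    then have "M a = m s * (\<Prod>i\<in>?S. m i)" unfolding vilenkin_base_def
      by (subst prod.remove[of _ s]) auto
    then show ?thesis using m_le by (simp add: mult_right_mono)
  next
    case False
    then have "?S = {..<a}" by auto
    then show ?thesis using B_ge_2 by (simp add: vilenkin_base_def)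
  qed
  then have "card {x \<in> trunc_group L. agree_but s a x u} * M a
      \<le> card {x \<in> trunc_group L. agree_but s a x u} * (B * (\<Prod>i\<in>?S. m i))"
    by (intro mult_left_mono) auto
  also have "\<dots> = B * M L"
    using card_fixed_coordinates[OF assms(1), of ?S L, unfolded eq] assms(2)
    by (subst mult.left_commute) force
  finally have "real (card {x \<in> trunc_group L. agree_but s a x u}) * real (M a)
      \<le> real B * real (M L)"
    by (metis of_nat_le_iff of_nat_mult)
  then show ?thesis by (simp add: pos_le_divide_eq)
qed

section \<open>Fejer kernels averaged over an interval\<close>

text \<open>The majorant of level \<open>N\<close> without its factor \<open>M\<^sub>N\<close>.\<close>

definition slab_sum :: "nat \<Rightarrow> (nat \<Rightarrow> nat) \<Rightarrow> (nat \<Rightarrow> nat) \<Rightarrow> real" where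
  "slab_sum N x u = (\<Sum>s\<le>N. real (M s) * of_bool (agree_but s N x u))"

lemma slab_sum_nonneg: "0 \<le> slab_sum N x u"
  unfolding slab_sum_def by (intro sum_nonneg) auto

text \<open>Levels up to \<open>N\<close> do not distinguish the points of an interval of level \<open>N\<close>.\<close>

lemma sum_majorant_cell_coarse:
  assumes "u \<in> vilenkin_group m" "a \<le> N" "N \<le> L"
  shows "(\<Sum>t\<in>cell L N u. majorant a x t) = real (M L) / real (M N) * majorant a x u"
proof -
  have "(\<Sum>t\<in>cell L N u. majorant a x t) = (\<Sum>t\<in>cell L N u. majorant a x u)"
    using assms(2) by (intro sum.cong refl) (auto simp: majorant_def agree_but_def cell_def
        agree_def)
  then show ?thesis using card_cell[OF assms(1,3)] by simp
qed

text \<open>A point counted on the left has its coordinates below \<open>N\<close> prescribed by \<open>u\<close> and those from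
  \<open>N\<close> to \<open>a\<close> prescribed by \<open>x\<close>, up to coordinate \<open>s\<close>. There is no such point unless \<open>x\<close> itself
  agrees with \<open>u\<close> below \<open>N\<close>, up to coordinate \<open>s\<close>; for \<open>s \<ge> N\<close> no exception remains, and
  \<open>min s N\<close> expresses both cases.\<close>

lemma card_cell_agree_but_le:
  assumes "u \<in> vilenkin_group m" "x \<in> vilenkin_group m" "N \<le> a" "a \<le> L"
  shows "real (card {t \<in> cell L N u. agree_but s a x t})
    \<le> of_bool (agree_but (min s N) N x u) * (B * real (M L) / real (M a))"
proof (cases "agree_but (min s N) N x u")
  case True
  \<comment> \<open>The point whose coordinates are the prescribed ones.\<close>
  define z where "z i = (if i < N then u i else x i)" for i
  have z: "z \<in> vilenkin_group m" using assms by (auto simp: z_def vilenkin_group_def)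
  have "{t \<in> cell L N u. agree_but s a x t} \<subseteq> {t \<in> trunc_group L. agree_but s a t z}"
    by (auto simp: cell_def agree_def agree_but_def z_def)
  then have "card {t \<in> cell L N u. agree_but s a x t}
      \<le> card {t \<in> trunc_group L. agree_but s a t z}"
    by (intro card_mono) auto
  also have "real \<dots> \<le> real B * real (M L) / real (M a)" using card_agree_but_le[OF z assms(4)] .
  finally show ?thesis using True by simp
next
  case False
  have "{t \<in> cell L N u. agree_but s a x t} = {}"
  proof (rule ccontr)
    assume "\<not> ?thesis"
    then obtain t where "agree N t u" "agree_but s a x t" by (auto simp: cell_def)
    then have "agree_but (min s N) N x u" using assms(3)
      by (auto simp: agree_def agree_but_def min_def)
    with False show False ..
  qed
  then show ?thesis by (simp add: False)
qed

text \<open>Ridges \<open>s \<le> N\<close> contribute \<open>slab_sum\<close>. Those with \<open>s > N\<close> are seen only from points \<open>x\<close> of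
  the interval; their weights add up to at most \<open>2 M\<^sub>a\<close>, while the last term of \<open>slab_sum\<close> is
  \<open>M\<^sub>N\<close> there.\<close>

lemma sum_majorant_cell_fine:
  assumes "u \<in> vilenkin_group m" "x \<in> vilenkin_group m" "N \<le> a" "a \<le> L"
  shows "(\<Sum>t\<in>cell L N u. majorant a x t)
      \<le> 3 * B * real (M L) / real (M N) * (real (M a) * slab_sum N x u)"
proof -
  let ?b = "\<lambda>s. of_bool (agree_but (min s N) N x u) :: real"
  have count: "(\<Sum>t\<in>cell L N u. of_bool (agree_but s a x t) :: real)
      = card {t \<in> cell L N u. agree_but s a x t}" for s
    by (simp add: Int_def)
  have "(\<Sum>t\<in>cell L N u. majorant a x t)
      = (\<Sum>s\<le>a. real (M a) * real (M s) * (\<Sum>t\<in>cell L N u. of_bool (agree_but s a x t)))"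
    unfolding majorant_def sum_distrib_left by (rule sum.swap)
  also have "\<dots> \<le> (\<Sum>s\<le>a. real (M a) * real (M s) * (?b s * (B * real (M L) / real (M a))))"
    unfolding count using assms by (intro sum_mono mult_left_mono card_cell_agree_but_le) auto
  also have "\<dots> = B * real (M L) * (\<Sum>s\<le>a. real (M s) * ?b s)"
    unfolding sum_distrib_left by (intro sum.cong refl) (simp add: field_simps)
  finally have swapped: "(\<Sum>t\<in>cell L N u. majorant a x t)
      \<le> B * real (M L) * (\<Sum>s\<le>a. real (M s) * ?b s)" .
  define q where "q = real (M a) / real (M N) * slab_sum N x u"
  have "(\<Sum>s\<le>a. real (M s) * ?b s) \<le> 3 * q"
  proof -
    have "(\<Sum>s\<le>a. real (M s) * ?b s) = (\<Sum>s\<le>N. real (M s) * ?b s) + (\<Sum>s\<in>{N<..a}. real (M s) * ?b s)"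
      using assms(3) by (subst sum.union_disjoint[symmetric]) (auto intro!: sum.cong)
    moreover have "(\<Sum>s\<le>N. real (M s) * ?b s) = slab_sum N x u"
      unfolding slab_sum_def by (intro sum.cong) (auto simp: min_def)
    moreover have "slab_sum N x u \<le> q"
      using M_mono[OF assms(3)]
        mult_right_mono[OF _ slab_sum_nonneg, of 1 "real (M a) / real (M N)" N x u]
      by (simp add: q_def)
    moreover have "(\<Sum>s\<in>{N<..a}. real (M s) * ?b s) \<le> 2 * q"
    proof -
      have "(\<Sum>s\<in>{N<..a}. real (M s) * ?b s)
          = (\<Sum>s\<in>{N<..a}. real (M s)) * of_bool (agree_but N N x u)"
        unfolding sum_distrib_right by (intro sum.cong) (auto simp: min_def)
      also have "\<dots> \<le> (2 * real (M a)) * of_bool (agree_but N N x u)"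
      proof (intro mult_right_mono)
        have "(\<Sum>s\<in>{N<..a}. real (M s)) \<le> (\<Sum>s\<le>a. real (M s))" by (intro sum_mono2) auto
        then show "(\<Sum>s\<in>{N<..a}. real (M s)) \<le> 2 * real (M a)" using sum_base_le[of a] by linarith
      qed simp
      also have "\<dots> = 2 * (real (M a) / real (M N) * (real (M N) * of_bool (agree_but N N x u)))"
        by simp
      also have "\<dots> \<le> 2 * q"
        unfolding slab_sum_def q_def
        by (intro mult_left_mono member_le_sum[of N "{..N}" "\<lambda>s. real (M s)
            * of_bool (agree_but s N x u)"]) auto
      finally show ?thesis .
    qed
    ultimately show ?thesis by linarith
  qed
  then have "B * real (M L) * (\<Sum>s\<le>a. real (M s) * ?b s) \<le> B * real (M L) * (3 * q)"
    by (intro mult_left_mono) auto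
  with swapped show ?thesis by (simp add: q_def mult_ac)
qed

section \<open>Fejer means of atoms\<close>

text \<open>The \<open>k\<close>-th Fejer mean of a function that depends only on the first \<open>L\<close> coordinates,
  provided that \<open>k < M\<^sub>L\<close>; see \<open>fejer_mean_eq_fejer_op\<close>.\<close>

definition fejer_op :: "nat \<Rightarrow> nat \<Rightarrow> ((nat \<Rightarrow> nat) \<Rightarrow> complex) \<Rightarrow> (nat \<Rightarrow> nat) \<Rightarrow> complex" where
  "fejer_op L k g x = (\<Sum>t\<in>trunc_group L. g t * fejer_sum k x t) / (of_nat k * of_nat (M L))"

lemma fejer_op_sum: "fejer_op L k (\<lambda>t. \<Sum>i\<in>I. g i t) x = (\<Sum>i\<in>I. fejer_op L k (g i) x)"
proof -
  have "(\<Sum>t\<in>trunc_group L. (\<Sum>i\<in>I. g i t) * fejer_sum k x t)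
      = (\<Sum>i\<in>I. \<Sum>t\<in>trunc_group L. g i t * fejer_sum k x t)"
    unfolding sum_distrib_right by (rule sum.swap)
  then show ?thesis by (simp add: fejer_op_def sum_divide_distrib)
qed

lemma fejer_sum_cong:
  assumes "k < M N" "agree N t u"
  shows "fejer_sum k x t = fejer_sum k x u"
  using assms vilenkin_fun_cong[OF _ assms(2)] unfolding fejer_sum_def dirichlet_def char_prod_def
  by (intro sum.cong refl) auto

lemma sum_supported_on_cell:
  fixes g h :: "(nat \<Rightarrow> nat) \<Rightarrow> complex"
  assumes "\<forall>t\<in>trunc_group L. t \<notin> cell L N u \<longrightarrow> g t = 0"
  shows "(\<Sum>t\<in>trunc_group L. g t * h t) = (\<Sum>t\<in>cell L N u. g t * h t)"
  using assms by (intro sum.mono_neutral_right) (auto simp: cell_def)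

text \<open>Functions with index below \<open>M\<^sub>N\<close> are constant on intervals of level \<open>N\<close>, and so is the
  kernel.\<close>

lemma fejer_op_mean_zero:
  assumes supp: "\<forall>t\<in>trunc_group L. t \<notin> cell L N u \<longrightarrow> g t = 0"
    and "(\<Sum>t\<in>cell L N u. g t) = 0" and "k < M N"
  shows "fejer_op L k g x = 0"
proof -
  have "(\<Sum>t\<in>cell L N u. g t * fejer_sum k x t) = (\<Sum>t\<in>cell L N u. g t * fejer_sum k x u)"
    using assms(3) by (intro sum.cong refl) (auto simp: cell_def intro: fejer_sum_cong)
  also have "\<dots> = 0" using assms(2) by (simp flip: sum_distrib_right)
  finally show ?thesis by (simp add: fejer_op_def sum_supported_on_cell[OF supp])
qed

text \<open>The kernel of order \<open>k\<close> has majorants of all levels up to the level \<open>A\<close> of \<open>k\<close>. Those up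
  to \<open>N\<close> are kept as they are; those above \<open>N\<close> grow geometrically after averaging, so that
  together they are of the size \<open>k\<close> of the last one, which cancels the denominator \<open>k\<close>.\<close>

lemma norm_fejer_op_le:
  assumes u: "u \<in> vilenkin_group m" and x: "x \<in> vilenkin_group m"
    and supp: "\<forall>t\<in>trunc_group L. t \<notin> cell L N u \<longrightarrow> g t = 0"
    and bound: "\<forall>t\<in>cell L N u. cmod (g t) \<le> c"
    and k: "M N \<le> k" "k < M L"
  shows "cmod (fejer_op L k g x)
    \<le> 18 * real B ^ 4 * c * ((\<Sum>a\<le>N. majorant a x u / (k * M N)) + slab_sum N x u / M N)"
proof -
  have c0: "0 \<le> c"
  proof -
    have "N \<le> L" using k M_mono[of L N] by (cases "N \<le> L") auto
    then have "0 < card (cell L N u)" using card_cell[OF u, of N L]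
      by (metis M_pos divide_pos_pos of_nat_0_less_iff)
    then obtain t where "t \<in> cell L N u" by (metis card_gt_0_iff ex_in_conv)
    then show ?thesis using bound norm_ge_zero order_trans by blast
  qed
  have k1: "1 \<le> k" using k(1) M_pos[of N] by linarith
  then obtain A where A: "M A \<le> k" "k < M (Suc A)" by (rule base_bracket)
  have NA: "N \<le> A" using k(1) A(2) M_mono[of "Suc A" N] by (cases "N \<le> A") auto
  have AL: "A < L" using k(2) A(1) M_mono[of L A] by (cases "A < L") auto
  define D where "D = 3 * real B ^ 3"
  let ?S = "\<Sum>a\<le>N. majorant a x u" and ?H = "slab_sum N x u"
  have H0: "0 \<le> ?H" by (rule slab_sum_nonneg)
  have S0: "0 \<le> ?S" by (intro sum_nonneg majorant_nonneg)
  have kernel: "(\<Sum>t\<in>cell L N u. \<Sum>a\<le>A. majorant a x t)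
      \<le> 6 * real B * real (M L) / real (M N) * (?S + real k * ?H)"
  proof -
    have "(\<Sum>t\<in>cell L N u. \<Sum>a\<le>A. majorant a x t) = (\<Sum>a\<le>A. \<Sum>t\<in>cell L N u. majorant a x t)"
      by (rule sum.swap)
    also have "\<dots> = (\<Sum>a\<le>N. \<Sum>t\<in>cell L N u. majorant a x t)
        + (\<Sum>a\<in>{N<..A}. \<Sum>t\<in>cell L N u. majorant a x t)"
      using NA by (subst sum.union_disjoint[symmetric]) (auto intro!: sum.cong)
    finally have split: "(\<Sum>t\<in>cell L N u. \<Sum>a\<le>A. majorant a x t) = \<dots>" .
    have "(\<Sum>a\<le>N. \<Sum>t\<in>cell L N u. majorant a x t) = real (M L) / real (M N) * ?S"
      unfolding sum_distrib_left using NA AL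
      by (intro sum.cong refl sum_majorant_cell_coarse u) auto
    also have "\<dots> \<le> 6 * real B * real (M L) / real (M N) * ?S"
      using B_ge_2 S0 by (intro mult_right_mono divide_right_mono) auto
    finally have coarse: "(\<Sum>a\<le>N. \<Sum>t\<in>cell L N u. majorant a x t) \<le> \<dots>" .
    have "(\<Sum>a\<in>{N<..A}. \<Sum>t\<in>cell L N u. majorant a x t)
        \<le> (\<Sum>a\<in>{N<..A}. 3 * B * real (M L) / real (M N) * (real (M a) * ?H))"
      using AL by (intro sum_mono sum_majorant_cell_fine u x) auto
    also have "\<dots> = 3 * B * real (M L) / real (M N) * ((\<Sum>a\<in>{N<..A}. real (M a)) * ?H)"
      by (simp only: sum_distrib_left sum_distrib_right)
    also have "\<dots> \<le> 3 * B * real (M L) / real (M N) * ((2 * real k) * ?H)"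
    proof (intro mult_left_mono mult_right_mono H0)
      have "(\<Sum>a\<in>{N<..A}. real (M a)) \<le> (\<Sum>a\<le>A. real (M a))" by (intro sum_mono2) auto
      also have "\<dots> \<le> 2 * real (M A)" by (rule sum_base_le)
      finally show "(\<Sum>a\<in>{N<..A}. real (M a)) \<le> 2 * real k" using A(1) by linarith
    qed simp
    also have "\<dots> = 6 * real B * real (M L) / real (M N) * (real k * ?H)" by simp
    finally have fine: "(\<Sum>a\<in>{N<..A}. \<Sum>t\<in>cell L N u. majorant a x t) \<le> \<dots>" .
    show ?thesis unfolding split distrib_left by (rule add_mono[OF coarse fine])
  qed
  have "cmod (\<Sum>t\<in>trunc_group L. g t * fejer_sum k x t)
      \<le> (\<Sum>t\<in>cell L N u. c * (D * (\<Sum>a\<le>A. majorant a x t)))"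
    unfolding sum_supported_on_cell[OF supp]
  proof (intro sum_norm_le)
    fix t assume t: "t \<in> cell L N u"
    then have "t \<in> vilenkin_group m" using trunc_group_subset by (auto simp: cell_def)
    then have "cmod (fejer_sum k x t) \<le> D * (\<Sum>a\<le>A. majorant a x t)"
      using norm_fejer_sum[OF x _ A(2)] by (simp add: D_def lessThan_Suc_atMost)
    then show "cmod (g t * fejer_sum k x t) \<le> c * (D * (\<Sum>a\<le>A. majorant a x t))"
      unfolding norm_mult using bound t c0 by (intro mult_mono) auto
  qed
  also have "\<dots> = c * D * (\<Sum>t\<in>cell L N u. \<Sum>a\<le>A. majorant a x t)"
    by (simp add: sum_distrib_left mult.assoc)
  also have "\<dots> \<le> c * D * (6 * real B * real (M L) / real (M N) * (?S + real k * ?H))"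
    using c0 by (intro mult_left_mono kernel) (simp add: D_def)
  finally have num: "cmod (\<Sum>t\<in>trunc_group L. g t * fejer_sum k x t) \<le> \<dots>" .
  have "cmod (fejer_op L k g x) = cmod (\<Sum>t\<in>trunc_group L. g t * fejer_sum k x t)
      / (real k * real (M L))"
    by (simp add: fejer_op_def norm_divide norm_mult)
  also have "\<dots> \<le> c * D * (6 * real B * real (M L) / real (M N) * (?S + real k * ?H))
      / (real k * real (M L))"
    by (intro divide_right_mono num) simp
  also have "\<dots> = 18 * real B ^ 4 * c * (?S / (real k * real (M N)) + ?H / real (M N))"
    using k1 by (simp add: D_def field_simps power_numeral_reduce)
  finally show ?thesis by (simp add: sum_divide_distrib)
qed

text \<open>The ridge \<open>s\<close> has relative size at most \<open>B / M\<^sub>a\<close>, and the heights \<open>M\<^sub>s\<close> form a geometric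
  sum.\<close>

lemma sum_slab_powr_le:
  assumes "0 < p" "u \<in> vilenkin_group m" "a \<le> L"
  shows "(\<Sum>x\<in>trunc_group L. \<Sum>s\<le>a. (real (M s) * of_bool (agree_but s a x u)) powr p)
    \<le> B * real (M L) / (1 - 2 powr (-p)) * real (M a) powr (p - 1)"
proof -
  have "(\<Sum>x\<in>trunc_group L. \<Sum>s\<le>a. (real (M s) * of_bool (agree_but s a x u)) powr p)
      = (\<Sum>s\<le>a. \<Sum>x\<in>trunc_group L. (real (M s) * of_bool (agree_but s a x u)) powr p)"
    by (rule sum.swap)
  also have "\<dots> = (\<Sum>s\<le>a. real (M s) powr p * real (card {x \<in> trunc_group L. agree_but s a x u}))"
  proof (intro sum.cong refl)
    fix s
    have "(\<Sum>x\<in>trunc_group L. (real (M s) * of_bool (agree_but s a x u)) powr p)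
        = (\<Sum>x\<in>trunc_group L. real (M s) powr p * of_bool (agree_but s a x u))"
      by (intro sum.cong) auto
    also have "\<dots> = real (M s) powr p * real (card {x \<in> trunc_group L. agree_but s a x u})"
      unfolding sum_distrib_left[symmetric] by (simp add: Int_def)
    finally show "(\<Sum>x\<in>trunc_group L. (real (M s) * of_bool (agree_but s a x u)) powr p) = \<dots>" .
  qed
  also have "\<dots> \<le> (\<Sum>s\<le>a. real (M s) powr p * (B * real (M L) / real (M a)))"
    using assms by (intro sum_mono mult_left_mono card_agree_but_le) auto
  also have "\<dots> = (B * real (M L) / real (M a)) * (\<Sum>s\<le>a. real (M s) powr p)"
    unfolding sum_distrib_left by (intro sum.cong refl mult.commute)
  also have "\<dots> \<le> (B * real (M L) / real (M a)) * (1 / (1 - 2 powr (-p)) * real (M a) powr p)"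
    using assms by (intro mult_left_mono sum_base_powr_le) auto
  also have "\<dots> = B * real (M L) / (1 - 2 powr (-p)) * (real (M a) powr p / real (M a))" by simp
  also have "real (M a) powr p / real (M a) = real (M a) powr (p - 1)" by (simp add: powr_diff)
  finally show ?thesis .
qed

text \<open>The powers may be taken term by term in \<open>norm_fejer_op_le\<close>. The level \<open>a\<close> then contributes
  \<open>M\<^sub>a\<^sup>p\<close> from the majorant and \<open>M\<^sub>a\<^bsup>p-1\<^esup>\<close> from \<open>sum_slab_powr_le\<close>.\<close>

lemma sum_fejer_op_powr_le:
  assumes u: "u \<in> vilenkin_group m"
    and supp: "\<forall>t\<in>trunc_group L. t \<notin> cell L N u \<longrightarrow> g t = 0"
    and bound: "\<forall>t\<in>cell L N u. cmod (g t) \<le> c"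
    and k: "M N \<le> k" "k < M L" and p: "0 < p" "p \<le> 1 / 2" and c: "0 \<le> c"
  shows "(\<Sum>x\<in>trunc_group L. cmod (fejer_op L k g x) powr p)
    \<le> (18 * real B ^ 4) powr p * B / (1 - 2 powr (-p)) * c powr p * real (M L) *
       ((real k * real (M N)) powr (-p) * (\<Sum>a\<le>N. real (M a) powr (2 * p - 1)) + 1 / real (M N))"
proof -
  define K where "K = real B * real (M L) / (1 - 2 powr (-p))"
  have k0: "0 < k" using k(1) M_pos[of N] by linarith
  have NL: "N \<le> L" using k M_mono[of L N] by (cases "N \<le> L") auto
  have slab: "slab_sum a x u powr p \<le> (\<Sum>s\<le>a. (real (M s)
      * of_bool (agree_but s a x u)) powr p)" for a x
    unfolding slab_sum_def using p by (intro powr_sum_le) auto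
  have sum_slab: "(\<Sum>x\<in>trunc_group L. slab_sum a x u powr p) \<le> K * real (M a) powr (p - 1)" if "a
      \<le> L" for a
    using sum_mono[OF slab] sum_slab_powr_le[OF p(1) u that] unfolding K_def by (rule order_trans)
  have maj: "majorant a x u = real (M a) * slab_sum a x u" for a x
    unfolding majorant_def slab_sum_def sum_distrib_left by (intro sum.cong refl mult.assoc)
  have pt: "cmod (fejer_op L k g x) powr p
      \<le> (18 * real B ^ 4) powr p * c powr p *
        ((\<Sum>a\<le>N. (real k * real (M N)) powr (-p) * real (M a) powr p * slab_sum a x u powr p)
          + real (M N) powr (-p) * slab_sum N x u powr p)"
    if "x \<in> trunc_group L" for x
  proof -
    have x: "x \<in> vilenkin_group m" using that trunc_group_subset by blast
    have nonneg: "0 \<le> majorant a x u / (real k * real (M N))" for a using majorant_nonneg by simp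
    have "cmod (fejer_op L k g x) powr p
       \<le> (18 * real B ^ 4 * c * ((\<Sum>a\<le>N. majorant a x u / (real k * real (M N)))
           + slab_sum N x u / real (M N))) powr p"
      using norm_fejer_op_le[OF u x supp bound k] p by (intro powr_mono2) auto
    also have "\<dots> = (18 * real B ^ 4) powr p * c powr p *
        ((\<Sum>a\<le>N. majorant a x u / (real k * real (M N))) + slab_sum N x u / real (M N)) powr p"
      using c nonneg slab_sum_nonneg by (simp add: powr_mult sum_nonneg add_nonneg_nonneg)
    also have "\<dots> \<le> (18 * real B ^ 4) powr p * c powr p *
        ((\<Sum>a\<le>N. (majorant a x u / (real k * real (M N))) powr p)
            + (slab_sum N x u / real (M N)) powr p)"
    proof (intro mult_left_mono)
      have "((\<Sum>a\<le>N. majorant a x u / (real k * real (M N))) + slab_sum N x u / real (M N)) powr p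
          \<le> (\<Sum>a\<le>N. majorant a x u / (real k * real (M N))) powr p
              + (slab_sum N x u / real (M N)) powr p"
        using p nonneg slab_sum_nonneg by (intro powr_add_le sum_nonneg) auto
      also have "(\<Sum>a\<le>N. majorant a x u / (real k * real (M N))) powr p
          \<le> (\<Sum>a\<le>N. (majorant a x u / (real k * real (M N))) powr p)"
        using p nonneg by (intro powr_sum_le) auto
      finally show "((\<Sum>a\<le>N. majorant a x u / (real k * real (M N)))
          + slab_sum N x u / real (M N)) powr p
          \<le> (\<Sum>a\<le>N. (majorant a x u / (real k * real (M N))) powr p)
              + (slab_sum N x u / real (M N)) powr p"
        by simp
    qed simp
    also have "(\<Sum>a\<le>N. (majorant a x u / (real k * real (M N))) powr p)
        = (\<Sum>a\<le>N. (real k * real (M N)) powr (-p) * real (M a) powr p * slab_sum a x u powr p)"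
      using slab_sum_nonneg by (intro sum.cong refl) (simp add: maj powr_divide powr_mult
          powr_minus divide_simps)
    also have "(slab_sum N x u / real (M N)) powr p
        = real (M N) powr (-p) * slab_sum N x u powr p"
      using slab_sum_nonneg by (simp add: powr_divide powr_minus divide_simps)
    finally show ?thesis .
  qed
  have "(\<Sum>x\<in>trunc_group L. cmod (fejer_op L k g x) powr p)
      \<le> (\<Sum>x\<in>trunc_group L. (18 * real B ^ 4) powr p * c powr p *
        ((\<Sum>a\<le>N. (real k * real (M N)) powr (-p) * real (M a) powr p * slab_sum a x u powr p)
          + real (M N) powr (-p) * slab_sum N x u powr p))"
    by (intro sum_mono pt)
  also have "\<dots> = (18 * real B ^ 4) powr p * c powr p *
      ((\<Sum>x\<in>trunc_group L. \<Sum>a\<le>N. (real k * real (M N)) powr (-p) * real (M a) powr p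
          * slab_sum a x u powr p)
       + real (M N) powr (-p) * (\<Sum>x\<in>trunc_group L. slab_sum N x u powr p))"
    by (simp only: sum_distrib_left[symmetric] sum.distrib)
  also have "(\<Sum>x\<in>trunc_group L. \<Sum>a\<le>N. (real k * real (M N)) powr (-p) * real (M a) powr p
      * slab_sum a x u powr p)
      = (\<Sum>a\<le>N. (real k * real (M N)) powr (-p) * real (M a) powr p
          * (\<Sum>x\<in>trunc_group L. slab_sum a x u powr p))"
    unfolding sum_distrib_left by (rule sum.swap)
  also have "(18 * real B ^ 4) powr p * c powr p *
      ((\<Sum>a\<le>N. (real k * real (M N)) powr (-p) * real (M a) powr p
          * (\<Sum>x\<in>trunc_group L. slab_sum a x u powr p))
       + real (M N) powr (-p) * (\<Sum>x\<in>trunc_group L. slab_sum N x u powr p))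
     \<le> (18 * real B ^ 4) powr p * c powr p *
      ((\<Sum>a\<le>N. (real k * real (M N)) powr (-p) * real (M a) powr p * (K * real (M a) powr (p - 1)))
       + real (M N) powr (-p) * (K * real (M N) powr (p - 1)))"
    using NL by (intro mult_left_mono add_mono sum_mono sum_slab) auto
  also have "(\<Sum>a\<le>N. (real k * real (M N)) powr (-p) * real (M a) powr p * (K
      * real (M a) powr (p - 1)))
      = K * ((real k * real (M N)) powr (-p) * (\<Sum>a\<le>N. real (M a) powr (2 * p - 1)))"
  proof -
    have "real (M a) powr p * real (M a) powr (p - 1) = real (M a) powr (2 * p - 1)" for a
      by (simp flip: powr_add)
    then show ?thesis unfolding sum_distrib_left by (intro sum.cong refl) (simp add: mult_ac)
  qed
  also have "real (M N) powr (-p) * (K * real (M N) powr (p - 1)) = K * (1 / real (M N))"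
  proof -
    have "real (M N) powr (-p) * real (M N) powr (p - 1) = 1 / real (M N)"
      unfolding powr_add[symmetric] by (simp add: powr_minus divide_inverse)
    then show ?thesis by (subst mult.left_commute) simp
  qed
  finally have "(\<Sum>x\<in>trunc_group L. cmod (fejer_op L k g x) powr p)
      \<le> (18 * real B ^ 4) powr p * c powr p * (K *
        ((real k * real (M N)) powr (-p) * (\<Sum>a\<le>N. real (M a) powr (2 * p - 1)) + 1 / real (M N)))"
    by (simp only: distrib_left)
  then show ?thesis by (simp add: K_def mult_ac)
qed

text \<open>Up to the factor \<open>1 / M\<^sub>L\<close>, the sum to be estimated.\<close>

definition fejer_energy :: "nat \<Rightarrow> real \<Rightarrow> nat \<Rightarrow> ((nat \<Rightarrow> nat) \<Rightarrow> complex) \<Rightarrow> real" where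
  "fejer_energy L p n g =
    (\<Sum>k=1..n. real k powr (2 * p - 2) * (\<Sum>x\<in>trunc_group L. cmod (fejer_op L k g x) powr p))"

text \<open>Constant functions count as atoms, through the case \<open>N = 0\<close>.\<close>

definition atom_bound :: "real \<Rightarrow> real \<Rightarrow> bool" where
  "atom_bound p C \<longleftrightarrow> (\<forall>L N u g c n. u \<in> vilenkin_group m \<longrightarrow>
    (\<forall>t\<in>trunc_group L. t \<notin> cell L N u \<longrightarrow> g t = 0) \<longrightarrow>
    (\<forall>t\<in>cell L N u. cmod (g t) \<le> c) \<longrightarrow> 0 \<le> c \<longrightarrow>
    (N = 0 \<or> (\<Sum>t\<in>cell L N u. g t) = 0) \<longrightarrow> 2 \<le> n \<longrightarrow> n < M L \<longrightarrow>
    fejer_energy L p n g \<le> C * log_factor p n * (c powr p * (real (M L) / real (M N))))"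

text \<open>Only the indices \<open>k \<ge> M\<^sub>N\<close> matter, by \<open>fejer_op_mean_zero\<close> or because \<open>M\<^sub>0 = 1\<close>. Weighting
  \<open>sum_fejer_op_powr_le\<close> by \<open>k\<^bsup>2p-2\<^esup>\<close> leaves a tail of \<open>\<Sum> k\<^bsup>p-2\<^esup>\<close>, of size \<open>M\<^sub>N\<^bsup>p-1\<^esup>\<close>, which turns
  \<open>M\<^sub>N\<^bsup>-p\<^esup>\<close> into \<open>1 / M\<^sub>N\<close>, and the sum of the weights, which has the factor \<open>1 / M\<^sub>N\<close> already.\<close>

lemma atom_estimate:
  assumes p: "0 < p" "p \<le> 1 / 2"
  shows "\<exists>C>0. atom_bound p C"
proof -
  obtain C1 where C1: "0 < C1" "\<And>n. 2 \<le> n \<Longrightarrow> (\<Sum>k=1..n. real k powr (2 * p - 2))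
      \<le> C1 * log_factor p n"
    using sum_weights_le[OF p] by blast
  obtain C2 where C2: "0 < C2" "\<And>n N. 2 \<le> n \<Longrightarrow> M N \<le> n \<Longrightarrow>
      (\<Sum>a\<le>N. real (M a) powr (2 * p - 1)) \<le> C2 * log_factor p n"
    using sum_base_powr_log_le[OF p] by blast
  define K where "K = (18 * real B ^ 4) powr p * B / (1 - 2 powr (-p))"
  have K: "0 < K" unfolding K_def using p B_ge_2
    by (intro divide_pos_pos mult_pos_pos) (auto simp: powr_less_one)
  define C where "C = K * (3 * C2 + C1)"
  have "0 < C" unfolding C_def using K C1 C2 by simp
  moreover have "(\<Sum>k=1..n. real k powr (2 * p - 2)
      * (\<Sum>x\<in>trunc_group L. cmod (fejer_op L k g x) powr p))
      \<le> C * log_factor p n * (c powr p * (real (M L) / real (M N)))"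
    if u: "u \<in> vilenkin_group m"
      and supp: "\<forall>t\<in>trunc_group L. t \<notin> cell L N u \<longrightarrow> g t = 0"
      and bound: "\<forall>t\<in>cell L N u. cmod (g t) \<le> c" and c: "0 \<le> c"
      and mean: "N = 0 \<or> (\<Sum>t\<in>cell L N u. g t) = 0" and n: "2 \<le> n" "n < M L" for L N u g c n
  proof -
    let ?w = "\<lambda>k. real k powr (2 * p - 2)"
    let ?F = "\<lambda>k. \<Sum>x\<in>trunc_group L. cmod (fejer_op L k g x) powr p"
    let ?R = "\<Sum>a\<le>N. real (M a) powr (2 * p - 1)"
    let ?mn = "real (M N)"
    have R0: "0 \<le> ?R" by (intro sum_nonneg) simp
    have l0: "0 < log_factor p n" using n by (intro log_factor_pos)
    have zero: "?F k = 0" if "k \<in> {1..n}" "k < M N" for k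
    proof -
      have "N \<noteq> 0" by (rule notI) (use that in simp)
      then have "fejer_op L k g x = 0" for x
        using supp mean that by (intro fejer_op_mean_zero[of L N u]) auto
      then show ?thesis by simp
    qed
    have M1: "1 \<le> M N" using M_pos[of N] by linarith
    have "(\<Sum>k=1..n. ?w k * ?F k) = (\<Sum>k=M N..n. ?w k * ?F k)"
      using M1 by (intro sum.mono_neutral_right) (auto simp: zero)
    also have "\<dots> \<le> (\<Sum>k=M N..n. ?w k * (K * c powr p * real (M L) * ((real k * ?mn) powr (-p)
        * ?R + 1 / ?mn)))"
      unfolding K_def using supp bound c n u
      by (intro sum_mono mult_left_mono sum_fejer_op_powr_le u p) auto
    also have "\<dots> = K * c powr p * real (M L) *
        (?mn powr (-p) * ?R * (\<Sum>k=M N..n. real k powr (p - 2)) + 1 / ?mn * (\<Sum>k=M N..n. ?w k))"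
    proof -
      have "?w k * (K * c powr p * real (M L) * ((real k * ?mn) powr (-p) * ?R + 1 / ?mn))
        = K * c powr p * real (M L) * (?mn powr (-p) * ?R * real k powr (p - 2) + 1 / ?mn
            * ?w k)" for k
      proof -
        have "?w k * (real k * ?mn) powr (-p) = ?mn powr (-p) * real k powr (p - 2)"
          by (simp add: powr_mult mult_ac flip: powr_add)
        then show ?thesis by (simp add: algebra_simps)
      qed
      then show ?thesis by (simp only: sum_distrib_left[symmetric] sum.distrib)
    qed
    also have "\<dots> \<le> K * c powr p * real (M L) * (1 / ?mn * ((3 * C2 + C1) * log_factor p n))"
    proof (intro mult_left_mono)
      have "?mn powr (-p) * ?R * (\<Sum>k=M N..n. real k powr (p - 2))
          \<le> 1 / ?mn * (3 * C2 * log_factor p n)"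
      proof (cases "M N \<le> n")
        case True
        have "?mn powr (-p) * ?R * (\<Sum>k=M N..n. real k powr (p - 2))
            \<le> ?mn powr (-p) * (C2 * log_factor p n) * (3 * ?mn powr (p - 1))"
          using sum_powr_tail_le[OF M1 p(2)] C2(2)[OF n(1) True] R0 C2(1) l0
          by (intro mult_mono) (auto intro!: sum_nonneg)
        also have "\<dots> = (?mn powr (-p) * ?mn powr (p - 1)) * (3 * C2 * log_factor p n)" by simp
        also have "?mn powr (-p) * ?mn powr (p - 1) = 1 / ?mn"
          unfolding powr_add[symmetric] by (simp add: powr_minus divide_inverse)
        finally show ?thesis .
      next
        case False
        then show ?thesis using C2 l0 by simp
      qed
      moreover have "1 / ?mn * (\<Sum>k=M N..n. ?w k) \<le> 1 / ?mn * (C1 * log_factor p n)"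
      proof (intro mult_left_mono)
        have "(\<Sum>k=M N..n. ?w k) \<le> (\<Sum>k=1..n. ?w k)" using M1 by (intro sum_mono2) auto
        also have "\<dots> \<le> C1 * log_factor p n" by (rule C1(2)[OF n(1)])
        finally show "(\<Sum>k=M N..n. ?w k) \<le> C1 * log_factor p n" .
      qed simp
      ultimately show "?mn powr (-p) * ?R * (\<Sum>k=M N..n. real k powr (p - 2)) + 1 / ?mn
          * (\<Sum>k=M N..n. ?w k)
          \<le> 1 / ?mn * ((3 * C2 + C1) * log_factor p n)"
        by (simp add: distrib_right add_divide_distrib)
    qed (use K in auto)
    also have "\<dots> = C * log_factor p n * (c powr p * (real (M L) / ?mn))" by (simp add: C_def)
    finally show ?thesis .
  qed
  ultimately show ?thesis unfolding atom_bound_def fejer_energy_def by blast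
qed

section \<open>Stopping times and the atomic decomposition\<close>

text \<open>The cells of level \<open>i + 1\<close> partition the cell of level \<open>i\<close>. Summing over points \<open>x\<close>
  instead of cells counts each cell once for each of its points, and all the cells have the same
  size.\<close>

lemma cell_sum_zero:
  fixes g :: "(nat \<Rightarrow> nat) \<Rightarrow> complex"
  assumes u: "u \<in> trunc_group L" and i: "i < L"
    and zero: "\<And>x. x \<in> cell L i u \<Longrightarrow> (\<Sum>y\<in>cell L (Suc i) x. g y) = 0"
  shows "(\<Sum>x\<in>cell L i u. g x) = 0"
proof -
  have "0 = (\<Sum>x\<in>cell L i u. \<Sum>y\<in>cell L (Suc i) x. g y)" using zero by simp
  also have "\<dots> = (\<Sum>x\<in>cell L i u. \<Sum>y\<in>cell L i u. if agree (Suc i) y x then g y else 0)"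
  proof (rule sum.cong[OF refl])
    fix x assume "x \<in> cell L i u"
    then have "cell L (Suc i) x = {y \<in> cell L i u. agree (Suc i) y x}"
      by (auto simp: cell_def intro: agree_trans_Suc)
    then show "(\<Sum>y\<in>cell L (Suc i) x. g y) = (\<Sum>y\<in>cell L i u. if agree (Suc i) y x then g y else 0)"
      by (simp add: sum.inter_filter)
  qed
  also have "\<dots> = (\<Sum>y\<in>cell L i u. \<Sum>x\<in>cell L i u. if agree (Suc i) y x then g y else 0)"
    by (rule sum.swap)
  also have "\<dots> = (\<Sum>y\<in>cell L i u. (real (M L) / real (M (Suc i))) * g y)"
  proof (rule sum.cong[OF refl])
    fix y assume y: "y \<in> cell L i u"
    have "{x \<in> cell L i u. agree (Suc i) y x} = cell L (Suc i) y"
      using y by (auto simp: cell_def intro: agree_sym agree_trans_Suc)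
    then have "(\<Sum>x\<in>cell L i u. if agree (Suc i) y x then g y else 0)
        = of_nat (card (cell L (Suc i) y)) * g y"
      by (simp add: sum.inter_filter[symmetric])
    moreover have "real (card (cell L (Suc i) y)) = real (M L) / real (M (Suc i))"
      using y i trunc_group_subset by (intro card_cell) (auto simp: cell_def)
    ultimately show "(\<Sum>x\<in>cell L i u. if agree (Suc i) y x then g y else 0)
        = (real (M L) / real (M (Suc i))) * g y" by (metis of_real_of_nat_eq)
  qed
  also have "\<dots> = (real (M L) / real (M (Suc i))) * (\<Sum>y\<in>cell L i u. g y)"
    by (simp only: sum_distrib_left)
  finally show ?thesis using m_pos[of i] by simp
qed

lemma fejer_op_cong:
  assumes "\<And>t. t \<in> trunc_group L \<Longrightarrow> g t = h t"
  shows "fejer_op L k g x = fejer_op L k h x"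
  unfolding fejer_op_def using assms by (intro arg_cong2[of _ _ _ _ "(/)"] sum.cong) auto

lemma fejer_energy_cong:
  assumes "\<And>t. t \<in> trunc_group L \<Longrightarrow> g t = h t"
  shows "fejer_energy L p n g = fejer_energy L p n h"
  unfolding fejer_energy_def using fejer_op_cong[OF assms] by simp

text \<open>The means are linear, and for \<open>p \<le> 1\<close> the \<open>p\<close>-th power of the modulus is subadditive.\<close>

lemma fejer_energy_sum_le:
  assumes "finite I" "0 < p" "p \<le> 1"
  shows "fejer_energy L p n (\<lambda>t. \<Sum>i\<in>I. g i t) \<le> (\<Sum>i\<in>I. fejer_energy L p n (g i))"
proof -
  have "fejer_energy L p n (\<lambda>t. \<Sum>i\<in>I. g i t)
      \<le> (\<Sum>k=1..n. real k powr (2 * p - 2) * (\<Sum>x\<in>trunc_group L. \<Sum>i\<in>I. cmod (fejer_op L k (g i) x)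
          powr p))"
    unfolding fejer_energy_def fejer_op_sum
  proof (intro sum_mono mult_left_mono)
    fix k x
    have "cmod (\<Sum>i\<in>I. fejer_op L k (g i) x) powr p \<le> (\<Sum>i\<in>I. cmod (fejer_op L k (g i) x)) powr p"
      using assms by (intro powr_mono2 norm_sum) auto
    also have "\<dots> \<le> (\<Sum>i\<in>I. cmod (fejer_op L k (g i) x) powr p)"
      using assms by (intro powr_sum_le) auto
    finally show "cmod (\<Sum>i\<in>I. fejer_op L k (g i) x) powr p
        \<le> (\<Sum>i\<in>I. cmod (fejer_op L k (g i) x) powr p)" .
  qed simp
  also have "\<dots> = (\<Sum>k=1..n. \<Sum>i\<in>I. real k powr (2 * p - 2)
      * (\<Sum>x\<in>trunc_group L. cmod (fejer_op L k (g i) x) powr p))"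
    unfolding sum_distrib_left[symmetric]
    by (intro sum.cong refl arg_cong2[of _ _ _ _ "(*)"] sum.swap)
  also have "\<dots> = (\<Sum>i\<in>I. fejer_energy L p n (g i))"
    unfolding fejer_energy_def by (rule sum.swap)
  finally show ?thesis .
qed

end

text \<open>A martingale observed up to time \<open>L\<close> on the finite quotient; the martingale property is
  stated as equality of sums over cells.\<close>

locale truncated_martingale = bounded_vilenkin +
  fixes L :: nat and f :: "nat \<Rightarrow> (nat \<Rightarrow> nat) \<Rightarrow> complex"
  assumes adapted: "\<lbrakk>i \<le> L; x \<in> trunc_group L; y \<in> trunc_group L; agree i x y\<rbrakk> \<Longrightarrow> f i x = f i y"
    and cell_mean: "\<lbrakk>i \<le> L; u \<in> trunc_group L\<rbrakk> \<Longrightarrow> (\<Sum>t\<in>cell L i u. f i t) = (\<Sum>t\<in>cell L i u. f L t)"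
begin

definition fmax :: "(nat \<Rightarrow> nat) \<Rightarrow> real" where
  "fmax x = Max ((\<lambda>i. cmod (f i x)) ` {..L})"

lemma norm_le_fmax: "i \<le> L \<Longrightarrow> cmod (f i x) \<le> fmax x"
  unfolding fmax_def by (intro Max_ge) auto

lemma fmax_nonneg: "0 \<le> fmax x"
  using norm_le_fmax[of 0 x] norm_ge_zero order_trans by blast

text \<open>The condition looks one step ahead, at all points of the current interval. Stopping at the
  first such time therefore stops before a value larger than \<open>\<theta>\<close> is taken after time \<open>0\<close>, and
  yet the decision to stop at time \<open>i\<close> depends on the first \<open>i\<close> coordinates only.\<close>

definition hits :: "real \<Rightarrow> nat \<Rightarrow> (nat \<Rightarrow> nat) \<Rightarrow> bool" where
  "hits \<theta> i x \<longleftrightarrow> (\<exists>y\<in>trunc_group L. agree i y x \<and> \<theta> < cmod (f (Suc i) y))"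

definition stop :: "real \<Rightarrow> (nat \<Rightarrow> nat) \<Rightarrow> nat" where
  "stop \<theta> x = (LEAST i. i = L \<or> hits \<theta> i x)"

definition stopped :: "real \<Rightarrow> (nat \<Rightarrow> nat) \<Rightarrow> complex" where
  "stopped \<theta> x = f (stop \<theta> x) x"

lemma stop_le: "stop \<theta> x \<le> L"
  unfolding stop_def by (rule Least_le) simp

lemma stop_hits: "stop \<theta> x < L \<Longrightarrow> hits \<theta> (stop \<theta> x) x"
  using LeastI[of "\<lambda>i. i = L \<or> hits \<theta> i x" L] unfolding stop_def by auto

lemma not_hits: "i < stop \<theta> x \<Longrightarrow> \<not> hits \<theta> i x"
  unfolding stop_def using not_less_Least by blast

lemma hits_cong: "agree j x y \<Longrightarrow> i \<le> j \<Longrightarrow> hits \<theta> i x = hits \<theta> i y"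
  unfolding hits_def using agree_trans agree_mono agree_sym by meson

text \<open>The first hitting time is a stopping time.\<close>

lemma stop_cong:
  assumes "agree (stop \<theta> x) x y"
  shows "stop \<theta> y = stop \<theta> x"
proof -
  have "stop \<theta> x = L \<or> hits \<theta> (stop \<theta> x) y"
    using stop_hits[of \<theta> x] stop_le[of \<theta> x] hits_cong[OF assms order.refl] by force
  moreover have "stop \<theta> x \<le> i" if "i = L \<or> hits \<theta> i y" for i
  proof (rule ccontr)
    assume "\<not> stop \<theta> x \<le> i"
    then have less: "i < stop \<theta> x" by simp
    then have "hits \<theta> i x" using that stop_le[of \<theta> x] hits_cong[OF assms, of i] by auto
    with not_hits[OF less] show False ..
  qed
  ultimately show ?thesis unfolding stop_def[of \<theta> y] by (rule Least_equality)
qed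

lemma stop_mono:
  assumes "\<theta> \<le> \<theta>'"
  shows "stop \<theta> x \<le> stop \<theta>' x"
proof -
  have "stop \<theta>' x = L \<or> hits \<theta> (stop \<theta>' x) x"
    using stop_hits[of \<theta>' x] stop_le[of \<theta>' x] assms unfolding hits_def by force
  then show ?thesis unfolding stop_def[of \<theta>] by (rule Least_le)
qed

text \<open>If the stopping time is positive, there was no hit one step earlier, and the value reached
  is one of those that were inspected then. At time \<open>0\<close> nothing has been inspected, hence the
  hypothesis on \<open>f 0\<close>.\<close>

lemma norm_stopped_le:
  assumes "x \<in> trunc_group L" "f 0 x = 0" "0 \<le> \<theta>"
  shows "cmod (stopped \<theta> x) \<le> \<theta>"
proof (cases "stop \<theta> x")
  case 0
  then show ?thesis using assms by (simp add: stopped_def)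
next
  case (Suc i)
  then have "\<not> hits \<theta> i x" by (intro not_hits) simp
  then show ?thesis using assms Suc by (auto simp: stopped_def hits_def not_less)
qed

text \<open>Downward induction on the level. A process stopped at time \<open>i\<close> at one point of the cell is
  stopped then on all of it, and the martingale property applies; otherwise it is stopped later
  everywhere, and the claim holds on the cells of the next level.\<close>

lemma optional_stopping:
  assumes "i \<le> L" "u \<in> trunc_group L" "\<And>x. x \<in> cell L i u \<Longrightarrow> i \<le> stop \<theta> x"
  shows "(\<Sum>x\<in>cell L i u. stopped \<theta> x - f L x) = 0"
  using assms
proof (induction "L - i" arbitrary: i u rule: less_induct)
  case less
  have uc: "u \<in> cell L i u" using less.prems(2) by (simp add: cell_def)
  show ?case
  proof (cases "stop \<theta> u = i")
    case True
    have "stop \<theta> x = i" if "x \<in> cell L i u" for x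
      using that True stop_cong[of \<theta> u x] by (simp add: cell_def agree_sym)
    then have "(\<Sum>x\<in>cell L i u. stopped \<theta> x) = (\<Sum>x\<in>cell L i u. f i x)"
      by (simp add: stopped_def)
    then show ?thesis using cell_mean[OF less.prems(1,2)] by (simp add: sum_subtractf)
  next
    case False
    have later: "Suc i \<le> stop \<theta> x" if "x \<in> cell L i u" for x
    proof -
      have "stop \<theta> x \<noteq> i" using that False stop_cong[of \<theta> x u] by (auto simp: cell_def)
      then show ?thesis using less.prems(3)[OF that] by simp
    qed
    have iL: "i < L" using later[OF uc] stop_le[of \<theta> u] by simp
    show ?thesis
    proof (rule cell_sum_zero[OF less.prems(2) iL])
      fix x assume x: "x \<in> cell L i u"
      show "(\<Sum>y\<in>cell L (Suc i) x. stopped \<theta> y - f L y) = 0"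
      proof (rule less.hyps)
        show "L - Suc i < L - i" "Suc i \<le> L" using iL by auto
        show "x \<in> trunc_group L" using x by (simp add: cell_def)
        fix y assume "y \<in> cell L (Suc i) x"
        then have "y \<in> cell L i u" using x by (auto simp: cell_def intro: agree_trans_Suc)
        then show "Suc i \<le> stop \<theta> y" by (rule later)
      qed
    qed
  qed
qed

text \<open>The intervals on which the process is stopped before time \<open>L\<close>, as pairs of a level and a
  point. Taking the point from the quotient of the same level makes it unique.\<close>

definition stop_cells :: "real \<Rightarrow> (nat \<times> (nat \<Rightarrow> nat)) set" where
  "stop_cells \<theta> = {(i, u). i < L \<and> u \<in> trunc_group i \<and> stop \<theta> u = i}"

lemma stop_cellsD:
  assumes "(i, u) \<in> stop_cells \<theta>"
  shows "i < L" "u \<in> trunc_group i" "u \<in> trunc_group L" "stop \<theta> u = i"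
    "\<And>x. x \<in> cell L i u \<Longrightarrow> stop \<theta> x = i"
proof -
  show *: "i < L" "u \<in> trunc_group i" "stop \<theta> u = i" using assms by (auto simp: stop_cells_def)
  then show "u \<in> trunc_group L" using trunc_group_mono[of i L] by auto
  show "stop \<theta> x = i" if "x \<in> cell L i u" for x
    using that *(3) stop_cong[of \<theta> u x] by (simp add: cell_def agree_sym)
qed

lemma finite_stop_cells [simp]: "finite (stop_cells \<theta>)"
proof (rule finite_subset)
  show "stop_cells \<theta> \<subseteq> {..<L} \<times> trunc_group L"
    using stop_cellsD by auto
qed simp

lemma stop_cells_disjoint:
  assumes "(i, u) \<in> stop_cells \<theta>" "(j, v) \<in> stop_cells \<theta>" "x \<in> cell L i u" "x \<in> cell L j v"
  shows "(i, u) = (j, v)"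
proof -
  have ij: "i = j" using stop_cellsD(5)[OF assms(1,3)] stop_cellsD(5)[OF assms(2,4)] by simp
  have "u k = v k" for k
  proof (cases "k < i")
    case True
    then show ?thesis using assms(3,4) ij by (auto simp: cell_def agree_def)
  next
    case False
    then show ?thesis using stop_cellsD(2)[OF assms(1)] stop_cellsD(2)[OF assms(2)] ij
      by (auto simp: trunc_group_def PiE_dflt_def)
  qed
  then show ?thesis using ij by auto
qed

lemma stop_cells_cover:
  assumes "x \<in> trunc_group L" "stop \<theta> x < L"
  shows "\<exists>i u. (i, u) \<in> stop_cells \<theta> \<and> x \<in> cell L i u"
proof -
  define i where "i = stop \<theta> x"
  define u where "u k = (if k < i then x k else 0)" for k
  have ag: "agree i x u" by (simp add: agree_def u_def)
  have "x \<in> vilenkin_group m" using assms(1) trunc_group_subset by blast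
  then have "u \<in> trunc_group i"
    by (simp add: trunc_group_def PiE_dflt_def u_def vilenkin_group_def)
  moreover have "stop \<theta> u = i" using stop_cong[of \<theta> x u] ag by (simp add: i_def)
  ultimately have "(i, u) \<in> stop_cells \<theta>" using assms(2) by (simp add: stop_cells_def i_def)
  moreover have "x \<in> cell L i u" using ag assms(1) by (simp add: cell_def)
  ultimately show ?thesis by blast
qed

text \<open>A stopping interval contains a child on which the maximal function exceeds \<open>\<theta>\<close>, and a
  child is at least the fraction \<open>1 / B\<close> of its parent. This is where boundedness of the
  sequence \<open>m\<close> enters the decomposition.\<close>

lemma sum_stop_cells_le:
  "(\<Sum>(i, u)\<in>stop_cells \<theta>. real (M L) / real (M i))
    \<le> B * real (card {x \<in> trunc_group L. \<theta> < fmax x})"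
proof -
  let ?S = "{x \<in> trunc_group L. \<theta> < fmax x}"
  have "real (M L) / real (M i) \<le> real B * real (card (cell L i u \<inter> ?S))"
      if iu: "(i, u) \<in> stop_cells \<theta>" for i u
  proof -
    note D = stop_cellsD[OF iu]
    obtain y where y: "y \<in> trunc_group L" "agree i y u" "\<theta> < cmod (f (Suc i) y)"
      using stop_hits[of \<theta> u] D unfolding hits_def by auto
    have "cell L (Suc i) y \<subseteq> cell L i u \<inter> ?S"
    proof
      fix x assume x: "x \<in> cell L (Suc i) y"
      then have "f (Suc i) x = f (Suc i) y" using y(1) D(1)
        by (intro adapted) (auto simp: cell_def)
      then have "\<theta> < fmax x" using y(3) norm_le_fmax[of "Suc i" x] D(1) by simp
      then show "x \<in> cell L i u \<inter> ?S" using x y(2) by (auto simp: cell_def intro: agree_trans_Suc)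
    qed
    then have "card (cell L (Suc i) y) \<le> card (cell L i u \<inter> ?S)" by (intro card_mono) auto
    moreover have "real (card (cell L (Suc i) y)) = real (M L) / real (M (Suc i))"
      using y(1) D(1) trunc_group_subset by (intro card_cell) auto
    ultimately have "real (M L) / real (M (Suc i)) \<le> real (card (cell L i u \<inter> ?S))" by linarith
    then have "real B * (real (M L) / real (M (Suc i))) \<le> real B * real (card (cell L i u \<inter> ?S))"
      by (intro mult_left_mono) auto
    moreover have "real (M L) / real (M i) = real (m i) * (real (M L) / real (M (Suc i)))"
      using m_pos[of i] by simp
    moreover have "real (m i) * (real (M L) / real (M (Suc i)))
        \<le> real B * (real (M L) / real (M (Suc i)))"
      using m_le[of i] by (intro mult_right_mono) auto
    ultimately show ?thesis by linarith
  qed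
  then have "(\<Sum>(i, u)\<in>stop_cells \<theta>. real (M L) / real (M i))
      \<le> (\<Sum>(i, u)\<in>stop_cells \<theta>. real B * real (card (cell L i u \<inter> ?S)))"
    by (intro sum_mono) auto
  also have "\<dots> = real B * real (\<Sum>(i, u)\<in>stop_cells \<theta>. card (cell L i u \<inter> ?S))"
    by (simp add: sum_distrib_left case_prod_beta)
  also have "(\<Sum>(i, u)\<in>stop_cells \<theta>. card (cell L i u \<inter> ?S))
      = card (\<Union>(i, u)\<in>stop_cells \<theta>. cell L i u \<inter> ?S)"
  proof (subst card_UN_disjoint)
    show "\<forall>a\<in>stop_cells \<theta>. \<forall>b\<in>stop_cells \<theta>. a \<noteq> b \<longrightarrow>
        (case a of (i, u) \<Rightarrow> cell L i u \<inter> ?S) \<inter> (case b of (i, u) \<Rightarrow> cell L i u \<inter> ?S) = {}"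
      using stop_cells_disjoint by fastforce
  qed (auto intro!: sum.cong)
  also have "\<dots> \<le> card ?S" by (intro card_mono) auto
  finally show ?thesis by (simp add: mult_left_mono)
qed

definition piece :: "real \<Rightarrow> nat \<times> (nat \<Rightarrow> nat) \<Rightarrow> (nat \<Rightarrow> nat) \<Rightarrow> complex" where
  "piece \<theta> a x = (if x \<in> cell L (fst a) (snd a) then stopped (2 * \<theta>) x - stopped \<theta> x else 0)"

text \<open>Where the process is not stopped before time \<open>L\<close> for \<open>\<theta>\<close>, neither is it for \<open>2\<theta>\<close>, and both
  sides vanish.\<close>

lemma sum_pieces:
  assumes "x \<in> trunc_group L" "0 < \<theta>"
  shows "(\<Sum>a\<in>stop_cells \<theta>. piece \<theta> a x) = stopped (2 * \<theta>) x - stopped \<theta> x"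
proof (cases "stop \<theta> x < L")
  case True
  then obtain i u where iu: "(i, u) \<in> stop_cells \<theta>" "x \<in> cell L i u"
    using stop_cells_cover[OF assms(1)] by blast
  have "piece \<theta> a x = 0" if "a \<in> stop_cells \<theta> - {(i, u)}" for a
    using that iu stop_cells_disjoint[of "fst a" "snd a" \<theta> i u x] by (auto simp: piece_def)
  then have "(\<Sum>a\<in>stop_cells \<theta>. piece \<theta> a x) = piece \<theta> (i, u) x"
    using iu(1) by (subst sum.remove[of _ "(i, u)"]) auto
  then show ?thesis using iu(2) by (simp add: piece_def)
next
  case False
  then have L: "stop \<theta> x = L" using stop_le[of \<theta> x] by simp
  then have "stop (2 * \<theta>) x = L" using stop_mono[of \<theta> "2 * \<theta>" x] stop_le[of "2 * \<theta>" x] assms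
    by simp
  moreover have "piece \<theta> a x = 0" if "a \<in> stop_cells \<theta>" for a
    using that L stop_cellsD(1,5)[of "fst a" "snd a" \<theta>] by (fastforce simp: piece_def)
  ultimately show ?thesis using L by (simp add: stopped_def)
qed

text \<open>A piece is an atom: it is supported on one stopping interval, bounded by \<open>2\<theta> + \<theta>\<close>, and has
  mean zero since by optional stopping both stopped processes have the mean of the final value
  there.\<close>

lemma fejer_energy_piece_le:
  assumes C: "atom_bound p C" and a: "a \<in> stop_cells \<theta>" and \<theta>: "0 < \<theta>" and n: "2 \<le> n" "n < M L"
    and f0: "\<And>x. x \<in> trunc_group L \<Longrightarrow> f 0 x = 0"
  shows "fejer_energy L p n (piece \<theta> a)
    \<le> C * log_factor p n * ((3 * \<theta>) powr p * (real (M L) / real (M (fst a))))"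
proof -
  obtain i u where iu: "a = (i, u)" by (cases a)
  note D = stop_cellsD[OF a[unfolded iu]]
  have sum0: "(\<Sum>x\<in>cell L i u. stopped (2 * \<theta>) x - stopped \<theta> x) = 0"
  proof -
    have "i \<le> stop (2 * \<theta>) x" "i \<le> stop \<theta> x" if "x \<in> cell L i u" for x
      using D(5)[OF that] stop_mono[of \<theta> "2 * \<theta>" x] \<theta> by auto
    then have "(\<Sum>x\<in>cell L i u. stopped (2 * \<theta>) x - f L x)
        = 0" "(\<Sum>x\<in>cell L i u. stopped \<theta> x - f L x) = 0"
      using D by (auto intro!: optional_stopping)
    then show ?thesis by (simp add: sum_subtractf)
  qed
  have bound: "cmod (piece \<theta> a x) \<le> 3 * \<theta>" if "x \<in> cell L i u" for x
  proof -
    have "x \<in> trunc_group L" using that by (simp add: cell_def)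
    then have "cmod (stopped (2 * \<theta>) x) \<le> 2 * \<theta>" "cmod (stopped \<theta> x) \<le> \<theta>"
      using f0 \<theta> by (auto intro!: norm_stopped_le)
    then have "cmod (stopped (2 * \<theta>) x - stopped \<theta> x) \<le> 3 * \<theta>"
      using norm_triangle_ineq4[of "stopped (2 * \<theta>) x" "stopped \<theta> x"] by linarith
    then show ?thesis using \<theta> by (simp add: piece_def)
  qed
  have u: "u \<in> vilenkin_group m" using D(3) trunc_group_subset by blast
  have supp: "\<forall>t\<in>trunc_group L. t \<notin> cell L i u \<longrightarrow> piece \<theta> a t = 0"
    by (simp add: piece_def iu)
  have mean: "(\<Sum>t\<in>cell L i u. piece \<theta> a t) = 0" using sum0 by (simp add: piece_def iu)
  show ?thesis
    using C[unfolded atom_bound_def, rule_format, of u L i "piece \<theta> a" "3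
        * \<theta>" n] u supp bound mean \<theta> n
    by (simp add: iu)
qed

text \<open>Only finitely many values occur, so that a lowest level below all nonzero ones and a
  highest level above all of them exist.\<close>

lemma exists_levels:
  "\<exists>\<delta>>0. \<exists>J. \<forall>i\<le>L. \<forall>x\<in>trunc_group L.
    (cmod (f i x) \<le> \<delta> \<longrightarrow> f i x = 0) \<and> cmod (f i x) \<le> \<delta> * 2 ^ J"
proof -
  \<comment> \<open>The element 1 makes the set nonempty, in case all values vanish.\<close>
  define V where "V = insert 1 ((\<lambda>(i, x). cmod (f i x)) ` ({..L} \<times> trunc_group L) - {0})"
  have fin: "finite V" by (simp add: V_def)
  have pos: "0 < v" if "v \<in> V" for v using that by (auto simp: V_def)
  define \<delta> where "\<delta> = Min V / 2"
  have "Min V \<in> V" using fin by (intro Min_in) (auto simp: V_def)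
  then have \<delta>: "0 < \<delta>" using pos by (simp add: \<delta>_def)
  obtain J where J: "Max V / \<delta> < 2 ^ J" using real_arch_pow[of 2 "Max V / \<delta>"] by auto
  have V: "cmod (f i x) = 0 \<or> cmod (f i x) \<in> V" if "i \<le> L" "x \<in> trunc_group L" for i x
    using that by (force simp: V_def)
  have "(cmod (f i x) \<le> \<delta> \<longrightarrow> f i x = 0) \<and> cmod (f i x) \<le> \<delta> * 2 ^ J"
    if "i \<le> L" "x \<in> trunc_group L" for i x
  proof (cases "f i x = 0")
    case True
    then show ?thesis using \<delta> by simp
  next
    case False
    then have v: "cmod (f i x) \<in> V" using V[OF that] by simp
    have "cmod (f i x) \<le> Max V" using fin v by (rule Max_ge)
    then have "cmod (f i x) \<le> \<delta> * 2 ^ J" using J \<delta> by (simp add: divide_less_eq mult.commute)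
    moreover have "\<delta> < cmod (f i x)" using Min_le[OF fin v] \<delta> by (simp add: \<delta>_def)
    ultimately show ?thesis by simp
  qed
  with \<delta> show ?thesis by blast
qed

text \<open>Between the lowest level, where the stopped process is zero, and the highest one, where it
  is the final value, the differences telescope to a decomposition into atoms.\<close>

lemma fejer_energy_le_centered:
  assumes C: "atom_bound p C" "0 < C" and p: "0 < p" "p \<le> 1 / 2" and n: "2 \<le> n" "n < M L"
    and f0: "\<And>x. x \<in> trunc_group L \<Longrightarrow> f 0 x = 0"
  shows "fejer_energy L p n (f L)
    \<le> C * 3 powr p * B / (1 - 2 powr (-p)) * log_factor p n * (\<Sum>x\<in>trunc_group L. fmax x powr p)"
proof -
  obtain \<delta> J where \<delta>: "0 < \<delta>"
    and small: "\<And>i x. i \<le> L \<Longrightarrow> x \<in> trunc_group L \<Longrightarrow> cmod (f i x) \<le> \<delta> \<Longrightarrow> f i x = 0"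
    and large: "\<And>i x. i \<le> L \<Longrightarrow> x \<in> trunc_group L \<Longrightarrow> cmod (f i x) \<le> \<delta> * 2 ^ J"
    using exists_levels by blast
  define \<theta> where "\<theta> j = \<delta> * 2 ^ j" for j :: nat
  have \<theta>: "0 < \<theta> j" "2 * \<theta> j = \<theta> (Suc j)" for j using \<delta> by (auto simp: \<theta>_def)
  let ?l = "log_factor p n"
  have l: "0 < ?l" using n by (intro log_factor_pos)
  have decomposition: "f L x = (\<Sum>j<J. \<Sum>a\<in>stop_cells (\<theta> j). piece (\<theta> j) a x)"
      if x: "x \<in> trunc_group L" for x
  proof -
    have "stopped (\<theta> 0) x = 0"
      unfolding stopped_def using norm_stopped_le[OF x f0[OF x], of \<delta>] \<delta> stop_le[of \<delta> x] x
      by (intro small) (auto simp: \<theta>_def stopped_def)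
    moreover have "stopped (\<theta> J) x = f L x"
    proof -
      have "\<not> stop (\<theta> J) x < L"
      proof
        assume less: "stop (\<theta> J) x < L"
        then obtain y where "y \<in> trunc_group L" "\<theta> J < cmod (f (Suc (stop (\<theta> J) x)) y)"
          using stop_hits[OF less] unfolding hits_def by blast
        then show False using large[of "Suc (stop (\<theta> J) x)" y] less by (simp add: \<theta>_def)
      qed
      then have "stop (\<theta> J) x = L" using stop_le[of "\<theta> J" x] by simp
      then show ?thesis by (simp add: stopped_def)
    qed
    ultimately have "f L x = stopped (\<theta> J) x - stopped (\<theta> 0) x" by simp
    also have "\<dots> = (\<Sum>j<J. stopped (\<theta> (Suc j)) x - stopped (\<theta> j) x)"
      by (rule sum_lessThan_telescope[symmetric])
    also have "\<dots> = (\<Sum>j<J. \<Sum>a\<in>stop_cells (\<theta> j). piece (\<theta> j) a x)"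
      using sum_pieces[OF x \<theta>(1)] by (simp add: \<theta>(2))
    finally show ?thesis .
  qed
  have "fejer_energy L p n (f L) = fejer_energy L p n (\<lambda>x. \<Sum>j<J. \<Sum>a\<in>stop_cells (\<theta> j). piece (\<theta>
      j) a x)"
    using decomposition by (rule fejer_energy_cong)
  also have "\<dots> \<le> (\<Sum>j<J. fejer_energy L p n (\<lambda>x. \<Sum>a\<in>stop_cells (\<theta> j). piece (\<theta> j) a x))"
    using p by (intro fejer_energy_sum_le) auto
  also have "\<dots> \<le> (\<Sum>j<J. \<Sum>a\<in>stop_cells (\<theta> j). fejer_energy L p n (piece (\<theta> j) a))"
    using p by (intro sum_mono fejer_energy_sum_le) auto
  also have "\<dots> \<le> (\<Sum>j<J. \<Sum>a\<in>stop_cells (\<theta> j). C * ?l * ((3 * \<theta> j) powr p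
      * (real (M L) / real (M (fst a)))))"
    using \<theta> n f0 C by (intro sum_mono fejer_energy_piece_le) auto
  also have "\<dots> = (\<Sum>j<J. C * ?l * (3 * \<theta> j) powr p
      * (\<Sum>(i, u)\<in>stop_cells (\<theta> j). real (M L) / real (M i)))"
    by (simp add: sum_distrib_left mult.assoc case_prod_beta)
  also have "\<dots> \<le> (\<Sum>j<J. C * ?l * (3 * \<theta> j) powr p * (B
      * real (card {x \<in> trunc_group L. \<theta> j < fmax x})))"
    using C l by (intro sum_mono mult_left_mono sum_stop_cells_le) auto
  also have "\<dots> = (\<Sum>j<J. C * ?l * 3 powr p * B * (\<Sum>x\<in>trunc_group L. \<theta> j powr p
      * of_bool (\<theta> j < fmax x)))"
  proof (rule sum.cong[OF refl])
    fix j
    have "(\<Sum>x\<in>trunc_group L. \<theta> j powr p * of_bool (\<theta> j < fmax x))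
        = \<theta> j powr p * real (card {x \<in> trunc_group L. \<theta> j < fmax x})"
      unfolding sum_distrib_left[symmetric] by (simp add: Int_def)
    then show "C * ?l * (3 * \<theta> j) powr p * (B * real (card {x \<in> trunc_group L. \<theta> j < fmax x}))
        = C * ?l * 3 powr p * B * (\<Sum>x\<in>trunc_group L. \<theta> j powr p * of_bool (\<theta> j < fmax x))"
      using \<theta>(1)[of j] by (simp add: powr_mult)
  qed
  also have "\<dots> = C * ?l * 3 powr p * B * (\<Sum>x\<in>trunc_group L. \<Sum>j<J. \<theta> j powr p
      * of_bool (\<theta> j < fmax x))"
    by (subst sum.swap) (simp only: sum_distrib_left)
  also have "\<dots> \<le> C * ?l * 3 powr p * B * (\<Sum>x\<in>trunc_group L. 1 / (1 - 2 powr (-p))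
      * fmax x powr p)"
    unfolding \<theta>_def using C l \<delta> p fmax_nonneg
    by (intro mult_left_mono sum_mono sum_levels_le) auto
  also have "\<dots> = C * 3 powr p * B / (1 - 2 powr (-p)) * ?l * (\<Sum>x\<in>trunc_group L. fmax x powr p)"
    unfolding sum_distrib_left[symmetric] by simp
  finally show ?thesis .
qed

text \<open>The initial value is split off as a multiple of the atom \<open>N = 0\<close>; the rest starts at zero
  and has a maximal function at most twice as large.\<close>

lemma fejer_energy_le:
  assumes C: "atom_bound p C" "0 < C" and p: "0 < p" "p \<le> 1 / 2" and n: "2 \<le> n" "n < M L"
  shows "fejer_energy L p n (f L)
    \<le> C * (6 powr p * B / (1 - 2 powr (-p)) + 1) * log_factor p n
        * (\<Sum>x\<in>trunc_group L. fmax x powr p)"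
proof -
  let ?l = "log_factor p n" and ?r = "1 - 2 powr (-p) :: real"
  define z :: "nat \<Rightarrow> nat" where "z = (\<lambda>_. 0)"
  have z: "z \<in> trunc_group L" by (auto simp: z_def trunc_group_def PiE_dflt_def)
  have l: "0 < ?l" using n by (intro log_factor_pos)
  have r: "0 < ?r" using p by (simp add: powr_less_one)
  have f0: "f 0 x = f 0 z" if "x \<in> trunc_group L" for x
    using that z by (intro adapted) (auto simp: agree_def)
  define h where "h i x = f i x - f 0 z" for i x
  interpret h: truncated_martingale m B L h
  proof
    show "h i x = h i y" if "i \<le> L" "x \<in> trunc_group L" "y \<in> trunc_group L" "agree i x y" for i
        x y
      using adapted[OF that] by (simp add: h_def)
    show "(\<Sum>t\<in>cell L i u. h i t) = (\<Sum>t\<in>cell L i u. h L t)" if "i \<le> L" "u \<in> trunc_group L" for i u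
      using cell_mean[OF that] by (simp add: h_def sum_subtractf)
  qed
  have "h.fmax x \<le> 2 * fmax x" if x: "x \<in> trunc_group L" for x
  proof -
    have "cmod (h i x) \<le> 2 * fmax x" if "i \<le> L" for i
    proof -
      have "cmod (h i x) \<le> cmod (f i x) + cmod (f 0 x)"
        unfolding h_def f0[OF x, symmetric] by (rule norm_triangle_ineq4)
      then show ?thesis using norm_le_fmax[OF that, of x] norm_le_fmax[of 0 x] by simp
    qed
    then show ?thesis unfolding h.fmax_def by (subst Max_le_iff) auto
  qed
  then have "(\<Sum>x\<in>trunc_group L. h.fmax x powr p) \<le> (\<Sum>x\<in>trunc_group L. (2 * fmax x) powr p)"
    using p h.fmax_nonneg by (intro sum_mono powr_mono2) auto
  also have "\<dots> = 2 powr p * (\<Sum>x\<in>trunc_group L. fmax x powr p)"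
    using fmax_nonneg by (simp add: powr_mult sum_distrib_left)
  finally have hmax: "(\<Sum>x\<in>trunc_group L. h.fmax x powr p) \<le> \<dots>" .
  have "fejer_energy L p n (h L) \<le> C * 3 powr p * B / ?r * ?l
      * (\<Sum>x\<in>trunc_group L. h.fmax x powr p)"
    using f0 by (intro h.fejer_energy_le_centered C p n) (auto simp: h_def)
  also have "\<dots> \<le> C * 3 powr p * B / ?r * ?l * (2 powr p * (\<Sum>x\<in>trunc_group L. fmax x powr p))"
    using hmax C l r by (intro mult_left_mono) auto
  also have "\<dots> = C * ((3 * 2) powr p * B / ?r) * ?l * (\<Sum>x\<in>trunc_group L. fmax x powr p)"
    unfolding powr_mult by simp
  finally have h_part: "fejer_energy L p n (h L)
      \<le> C * (6 powr p * B / ?r) * ?l * (\<Sum>x\<in>trunc_group L. fmax x powr p)"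
    by simp
  have const_part: "fejer_energy L p n (\<lambda>_. f 0 z) \<le> C * ?l * (\<Sum>x\<in>trunc_group L. fmax x powr p)"
  proof -
    have "cell L 0 z = trunc_group L" by (auto simp: cell_def agree_def)
    then have "fejer_energy L p n (\<lambda>_. f 0 z)
        \<le> C * ?l * (cmod (f 0 z) powr p * (real (M L) / real (M 0)))"
      using C(1)[unfolded atom_bound_def, rule_format, of z L 0 "\<lambda>_. f 0 z" "cmod (f 0 z)" n] z
          trunc_group_subset n
      by auto
    also have "cmod (f 0 z) powr p * (real (M L) / real (M 0))
        = (\<Sum>x\<in>trunc_group L. cmod (f 0 z) powr p)"
      by (simp add: card_trunc_group)
    also have "\<dots> \<le> (\<Sum>x\<in>trunc_group L. fmax x powr p)"
      using p norm_le_fmax[of 0] by (intro sum_mono powr_mono2) (auto simp flip: f0)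
    finally show ?thesis using C l by (simp add: mult_left_mono)
  qed
  \<comment> \<open>A sum over a two-element index set, to apply subadditivity for finite sums.\<close>
  have "fejer_energy L p n (f L) = fejer_energy L p n (\<lambda>x. \<Sum>b\<in>{True, False}. (if b then h L x
      else f 0 z))"
    by (rule fejer_energy_cong) (simp add: h_def)
  also have "\<dots> \<le> (\<Sum>b\<in>{True, False}. fejer_energy L p n (\<lambda>x. if b then h L x else f 0 z))"
    using p by (intro fejer_energy_sum_le) auto
  also have "\<dots> = fejer_energy L p n (h L) + fejer_energy L p n (\<lambda>_. f 0 z)" by simp
  also have "\<dots> \<le> C * (6 powr p * B / ?r + 1) * ?l * (\<Sum>x\<in>trunc_group L. fmax x powr p)"
    using h_part const_part by (simp add: algebra_simps)
  finally show ?thesis .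
qed

end

section \<open>From the Vilenkin group to its finite quotients\<close>

lemma ennpowr_ennreal: "0 \<le> x \<Longrightarrow> ennpowr (ennreal x) p = ennreal (x powr p)"
  by (simp add: ennpowr_def)

text \<open>With it the \<open>p\<close>-th power of a quasi-norm becomes an integral.\<close>

lemma ennpowr_ennpowr_inverse:
  assumes "0 < p"
  shows "ennpowr (ennpowr y (1 / p)) p = y"
proof (cases "y = \<infinity>")
  case False
  then have "ennreal (enn2real y) = y" by (intro ennreal_enn2real) (simp add: less_top)
  then show ?thesis using False assms by (simp add: ennpowr_def powr_powr)
qed (simp add: ennpowr_def)

lemma ennpowr_vilenkin_Lp_norm:
  "0 < p \<Longrightarrow> ennpowr (vilenkin_Lp_norm m p g) p = (\<integral>\<^sup>+ x. ennpowr (g x) p \<partial>vilenkin_measure m)"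
  unfolding vilenkin_Lp_norm_def by (rule ennpowr_ennpowr_inverse)

context bounded_vilenkin
begin

abbreviation \<mu> :: "(nat \<Rightarrow> nat) measure" where "\<mu> \<equiv> vilenkin_measure m"

lemma prob_space_\<mu>: "prob_space \<mu>"
  using m_ge_2 by (rule prob_space_vilenkin_measure)

lemma measure_interval:
  assumes "u \<in> vilenkin_group m"
  shows "measure \<mu> (vilenkin_interval m n u) = 1 / real (M n)"
  using emeasure_vilenkin_interval[of m u n] m_ge_2 assms by (simp add: measure_def)

definition restrict_point :: "nat \<Rightarrow> (nat \<Rightarrow> nat) \<Rightarrow> nat \<Rightarrow> nat" where
  "restrict_point L x k = (if k < L then x k else 0)"

lemma restrict_point_in: "x \<in> vilenkin_group m \<Longrightarrow> restrict_point L x \<in> trunc_group L"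
  by (simp add: trunc_group_def PiE_dflt_def restrict_point_def vilenkin_group_def)

lemma agree_restrict_point: "agree L x (restrict_point L x)"
  by (simp add: agree_def restrict_point_def)

lemma interval_iff_restrict_point:
  assumes "v \<in> trunc_group L" "x \<in> vilenkin_group m"
  shows "x \<in> vilenkin_interval m L v \<longleftrightarrow> v = restrict_point L x"
proof
  assume "x \<in> vilenkin_interval m L v"
  then have "x k = v k" if "k < L" for k using that by (simp add: vilenkin_interval_def)
  moreover have "v k = 0" if "\<not> k < L" for k using that assms(1)
    by (simp add: trunc_group_def PiE_dflt_def)
  ultimately show "v = restrict_point L x" by (auto simp: restrict_point_def)
qed (use assms in \<open>auto simp: vilenkin_interval_def restrict_point_def\<close>)

lemma sum_indicator_interval:
  fixes g :: "(nat \<Rightarrow> nat) \<Rightarrow> 'b :: semiring_1"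
  assumes "x \<in> vilenkin_group m"
  shows "(\<Sum>v\<in>trunc_group L. g v * indicator (vilenkin_interval m L v) x) = g (restrict_point L x)"
proof -
  have "(\<Sum>v\<in>trunc_group L. g v * indicator (vilenkin_interval m L v) x)
      = (\<Sum>v\<in>trunc_group L. if v = restrict_point L x then g v else 0)"
    using assms by (intro sum.cong refl) (auto simp: indicator_def interval_iff_restrict_point)
  also have "\<dots> = g (restrict_point L x)" using restrict_point_in[OF assms]
    by (simp add: sum.delta')
  finally show ?thesis .
qed

lemma nn_integral_cylinder:
  fixes g :: "(nat \<Rightarrow> nat) \<Rightarrow> ennreal"
  assumes "\<And>x. x \<in> vilenkin_group m \<Longrightarrow> g x = g (restrict_point L x)"
  shows "(\<integral>\<^sup>+ x. g x \<partial>\<mu>) = (\<Sum>v\<in>trunc_group L. g v * ennreal (1 / real (M L)))"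
proof -
  have "(\<integral>\<^sup>+ x. g x \<partial>\<mu>) = (\<integral>\<^sup>+ x. (\<Sum>v\<in>trunc_group L. g v
      * indicator (vilenkin_interval m L v) x) \<partial>\<mu>)"
    by (intro nn_integral_cong) (simp only: sum_indicator_interval space_vilenkin_measure, rule
        assms)
  also have "\<dots> = (\<Sum>v\<in>trunc_group L. \<integral>\<^sup>+ x. g v * indicator (vilenkin_interval m L v) x \<partial>\<mu>)"
    by (intro nn_integral_sum borel_measurable_times_ennreal borel_measurable_const
        borel_measurable_indicator
        sets_vilenkin_interval subsetD[OF trunc_group_subset])
  also have "\<dots> = (\<Sum>v\<in>trunc_group L. g v * ennreal (1 / real (M L)))"
  proof (rule sum.cong[OF refl])
    fix v assume "v \<in> trunc_group L"
    then have v: "v \<in> vilenkin_group m" using trunc_group_subset by blast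
    show "(\<integral>\<^sup>+ x. g v * indicator (vilenkin_interval m L v) x \<partial>\<mu>) = g v * ennreal (1 / real (M L))"
      using emeasure_vilenkin_interval[of m v L] m_ge_2 v
      by (simp add: nn_integral_cmult_indicator sets_vilenkin_interval)
  qed
  finally show ?thesis .
qed

lemma integral_cylinder_mult:
  fixes F w :: "(nat \<Rightarrow> nat) \<Rightarrow> complex"
  assumes F: "integrable \<mu> F" and w: "\<And>x. x \<in> vilenkin_group m \<Longrightarrow> w x = w (restrict_point L x)"
  shows "(LINT x|\<mu>. F x * w x) = (\<Sum>v\<in>trunc_group L. (LINT x:vilenkin_interval m L v|\<mu>. F x)
      * w v)"
proof -
  have sets: "vilenkin_interval m L v \<in> sets \<mu>" if "v \<in> trunc_group L" for v
    using that trunc_group_subset by (intro sets_vilenkin_interval) auto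
  have "(LINT x|\<mu>. F x * w x)
      = (LINT x|\<mu>. (\<Sum>v\<in>trunc_group L. (indicator (vilenkin_interval m L v) x *\<^sub>R F x) * w v))"
  proof (rule Bochner_Integration.integral_cong[OF refl])
    fix x assume "x \<in> space \<mu>"
    then have x: "x \<in> vilenkin_group m" by simp
    have "F x * w x = F x * (\<Sum>v\<in>trunc_group L. w v * indicator (vilenkin_interval m L v) x)"
      using w[OF x] by (simp only: sum_indicator_interval[OF x])
    also have "\<dots> = (\<Sum>v\<in>trunc_group L. (indicator (vilenkin_interval m L v) x *\<^sub>R F x) * w v)"
      unfolding sum_distrib_left by (intro sum.cong refl) (simp add: indicator_def)
    finally show "F x * w x = \<dots>" .
  qed
  also have "\<dots> = (\<Sum>v\<in>trunc_group L. LINT x|\<mu>. (indicator (vilenkin_interval m L v) x *\<^sub>R F x)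
      * w v)"
    using F sets by (intro Bochner_Integration.integral_sum integrable_mult_left
        integrable_mult_indicator) auto
  also have "\<dots> = (\<Sum>v\<in>trunc_group L. (LINT x:vilenkin_interval m L v|\<mu>. F x) * w v)"
    unfolding set_lebesgue_integral_def by (simp only: integral_mult_left_zero)
  finally show ?thesis .
qed

text \<open>The sets that contain both of two given points or none of them are closed under the
  operations of a sigma-algebra.\<close>

lemma filtration_sets_constant:
  assumes "A \<in> sets (vilenkin_filtration m n)" "x \<in> vilenkin_group m" "y \<in> vilenkin_group m"
      "agree n x y"
  shows "x \<in> A \<longleftrightarrow> y \<in> A"
proof -
  have "A \<in> sigma_sets (vilenkin_group m) {vilenkin_interval m n x | x. x \<in> vilenkin_group m}"
    using assms(1) unfolding vilenkin_filtration_def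
    by (subst (asm) sets_measure_of) (auto simp: vilenkin_interval_def)
  then show ?thesis
  proof (induction rule: sigma_sets.induct)
    case (Basic a)
    then show ?case using assms by (auto simp: vilenkin_interval_def agree_def)
  qed (use assms in auto)
qed

lemma filtration_measurable_constant:
  fixes g :: "(nat \<Rightarrow> nat) \<Rightarrow> complex"
  assumes g: "g \<in> borel_measurable (vilenkin_filtration m n)"
    and xy: "x \<in> vilenkin_group m" "y \<in> vilenkin_group m" "agree n x y"
  shows "g x = g y"
proof -
  have sp: "space (vilenkin_filtration m n) = vilenkin_group m"
    by (simp add: vilenkin_filtration_def space_measure_of_conv)
  have "g -` {g y} \<inter> space (vilenkin_filtration m n) \<in> sets (vilenkin_filtration m n)"
    using g by (rule measurable_sets) simp
  from filtration_sets_constant[OF this xy] show ?thesis using xy by (simp add: sp)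
qed

text \<open>Integrating the conditional expectation over an interval removes the exceptional null
  sets: the martingale property, which holds almost everywhere, becomes an identity at every
  point because intervals have positive measure.\<close>

lemma martingale_interval_mean:
  assumes f: "vilenkin_martingale m f" and nk: "n \<le> k" and u: "u \<in> vilenkin_group m"
  shows "(LINT x:vilenkin_interval m n u|\<mu>. f k x) = f n u / of_nat (M n)"
proof -
  interpret prob_space \<mu> by (rule prob_space_\<mu>)
  let ?F = "vilenkin_filtration m n" and ?A = "vilenkin_interval m n u"
  interpret finite_measure_subalgebra \<mu> ?F
    by unfold_locales (rule subalgebra_vilenkin_filtration)
  have int: "integrable \<mu> (f j)" for j using f by (simp add: vilenkin_martingale_def)
  have meas: "f n \<in> borel_measurable ?F" using f by (simp add: vilenkin_martingale_def)
  have AF: "?A \<in> sets ?F"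
    unfolding vilenkin_filtration_def using u
    by (subst sets_measure_of) (auto simp: vilenkin_interval_def intro!: sigma_sets.Basic)
  have A: "?A \<in> sets \<mu>" by (rule sets_vilenkin_interval[OF u])
  have ce: "AE x in \<mu>. complex_cond_exp \<mu> ?F (f k) x = f n x"
    using f nk by (simp add: vilenkin_martingale_def)
  have "(LINT x:?A|\<mu>. Re (f k x)) = (LINT x:?A|\<mu>. Re (f n x))"
  proof -
    have "(LINT x:?A|\<mu>. Re (f k x)) = (LINT x:?A|\<mu>. real_cond_exp \<mu> ?F (\<lambda>x. Re (f k x)) x)"
      using int AF by (intro real_cond_exp_intA) auto
    also have "\<dots> = (LINT x:?A|\<mu>. Re (f n x))"
    proof (rule set_lebesgue_integral_cong_AE[OF A])
      show "AE x \<in> ?A in \<mu>. real_cond_exp \<mu> ?F (\<lambda>x. Re (f k x)) x = Re (f n x)"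
        using ce by eventually_elim (simp add: complex_cond_exp_def complex_eq_iff)
    qed (use int[of n] in auto)
    finally show ?thesis .
  qed
  moreover have "(LINT x:?A|\<mu>. Im (f k x)) = (LINT x:?A|\<mu>. Im (f n x))"
  proof -
    have "(LINT x:?A|\<mu>. Im (f k x)) = (LINT x:?A|\<mu>. real_cond_exp \<mu> ?F (\<lambda>x. Im (f k x)) x)"
      using int AF by (intro real_cond_exp_intA) auto
    also have "\<dots> = (LINT x:?A|\<mu>. Im (f n x))"
    proof (rule set_lebesgue_integral_cong_AE[OF A])
      show "AE x \<in> ?A in \<mu>. real_cond_exp \<mu> ?F (\<lambda>x. Im (f k x)) x = Im (f n x)"
        using ce by eventually_elim (simp add: complex_cond_exp_def complex_eq_iff)
    qed (use int[of n] in auto)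
    finally show ?thesis .
  qed
  moreover have "Re (LINT x:?A|\<mu>. f j x) = (LINT x:?A|\<mu>. Re (f j x))"
    "Im (LINT x:?A|\<mu>. f j x) = (LINT x:?A|\<mu>. Im (f j x))" for j
    using integrable_mult_indicator[OF A int[of j]]
    by (simp_all add: set_lebesgue_integral_def flip: integral_Re integral_Im)
  ultimately have "(LINT x:?A|\<mu>. f k x) = (LINT x:?A|\<mu>. f n x)" by (simp add: complex_eq_iff)
  also have "\<dots> = (LINT x:?A|\<mu>. f n u)"
  proof (rule set_lebesgue_integral_cong[OF A], intro allI impI)
    fix x assume "x \<in> ?A"
    then show "f n x = f n u"
      using u by (intro filtration_measurable_constant[OF meas]) (auto simp:
          vilenkin_interval_def agree_def)
  qed
  also have "\<dots> = f n u / of_nat (M n)"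
    using A by (simp add: set_integral_const measure_interval[OF u] scaleR_conv_of_real)
  finally show ?thesis .
qed

text \<open>Both sides of the mean value identity are multiples of the integral of \<open>f L\<close> over the
  interval of level \<open>i\<close>, computed as a whole or piece by piece on intervals of level \<open>L\<close>.\<close>

lemma truncated_martingaleI:
  assumes f: "vilenkin_martingale m f"
  shows "truncated_martingale m B L f"
proof
  have meas: "f i \<in> borel_measurable (vilenkin_filtration m i)" for i
    using f by (simp add: vilenkin_martingale_def)
  show adapted: "f i x = f i y" if "i \<le> L" "x \<in> trunc_group L" "y \<in> trunc_group L" "agree i x y"
      for i x y
    using that trunc_group_subset by (intro filtration_measurable_constant[OF meas]) auto
  show "(\<Sum>t\<in>cell L i u. f i t) = (\<Sum>t\<in>cell L i u. f L t)" if "i \<le> L" "u \<in> trunc_group L" for i u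
  proof -
    have u: "u \<in> vilenkin_group m" using that trunc_group_subset by auto
    have "(\<Sum>t\<in>cell L i u. f i t) = (\<Sum>t\<in>cell L i u. f i u)"
      using that by (intro sum.cong refl adapted) (auto simp: cell_def)
    also have "\<dots> = of_real (real (M L) / real (M i)) * f i u"
      by (simp flip: card_cell[OF u that(1)])
    also have "\<dots> = of_nat (M L) * (f i u / of_nat (M i))" by simp
    also have "f i u / of_nat (M i) = (LINT x:vilenkin_interval m i u|\<mu>. f L x)"
      using martingale_interval_mean[OF f that(1) u] by simp
    also have "\<dots> = (LINT x|\<mu>. f L x * of_bool (agree i x u))"
      unfolding set_lebesgue_integral_def
      by (rule Bochner_Integration.integral_cong) (auto simp: vilenkin_interval_def agree_def
          indicator_def)
    also have "\<dots> = (\<Sum>v\<in>trunc_group L. (LINT x:vilenkin_interval m L v|\<mu>. f L x)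
        * of_bool (agree i v u))"
    proof (rule integral_cylinder_mult)
      show "integrable \<mu> (f L)" using f by (simp add: vilenkin_martingale_def)
      show "(of_bool (agree i x u) :: complex) = of_bool (agree i (restrict_point L x) u)" for x
        using that(1) by (simp add: agree_def restrict_point_def)
    qed
    also have "\<dots> = (\<Sum>v\<in>trunc_group L. f L v / of_nat (M L) * of_bool (agree i v u))"
      by (intro sum.cong refl)
        (simp add: martingale_interval_mean[OF f order.refl] subsetD[OF trunc_group_subset])
    also have "\<dots> = (\<Sum>v\<in>cell L i u. f L v / of_nat (M L))"
      unfolding cell_def by (intro sum.mono_neutral_cong_right) auto
    also have "of_nat (M L) * \<dots> = (\<Sum>t\<in>cell L i u. f L t)"
      by (simp flip: sum_divide_distrib)
    finally show ?thesis .
  qed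
qed

text \<open>The sequence whose limit defines the coefficient is constant from \<open>L\<close> on.\<close>

lemma vilenkin_coeff_martingale:
  assumes f: "vilenkin_martingale m f" and i: "i < M L"
  shows "vilenkin_coeff m f i = (\<Sum>v\<in>trunc_group L. f L v
      * cnj (vilenkin_fun m i v)) / of_nat (M L)"
proof -
  have "(LINT x|\<mu>. f k x * cnj (vilenkin_fun m i x))
      = (\<Sum>v\<in>trunc_group L. f L v * cnj (vilenkin_fun m i v)) / of_nat (M L)" if "L \<le> k" for k
  proof -
    have "(LINT x|\<mu>. f k x * cnj (vilenkin_fun m i x))
        = (\<Sum>v\<in>trunc_group L. (LINT x:vilenkin_interval m L v|\<mu>. f k x)
            * cnj (vilenkin_fun m i v))"
    proof (rule integral_cylinder_mult)
      show "integrable \<mu> (f k)" using f by (simp add: vilenkin_martingale_def)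
      show "cnj (vilenkin_fun m i x) = cnj (vilenkin_fun m i (restrict_point L x))" for x
        using vilenkin_fun_cong[OF i agree_restrict_point] by simp
    qed
    also have "\<dots> = (\<Sum>v\<in>trunc_group L. f L v / of_nat (M L) * cnj (vilenkin_fun m i v))"
      by (intro sum.cong refl)
        (simp add: martingale_interval_mean[OF f that] subsetD[OF trunc_group_subset])
    finally show ?thesis by (simp add: sum_divide_distrib)
  qed
  then have "eventually (\<lambda>k. (LINT x|\<mu>. f k x * cnj (vilenkin_fun m i x))
      = (\<Sum>v\<in>trunc_group L. f L v * cnj (vilenkin_fun m i v)) / of_nat (M L)) sequentially"
    unfolding eventually_sequentially by blast
  then show ?thesis unfolding vilenkin_coeff_def by (intro limI tendsto_eventually)
qed

lemma fejer_mean_eq_fejer_op: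
  assumes f: "vilenkin_martingale m f" and k: "k < M L"
  shows "fejer_mean m f k x = fejer_op L k (f L) x"
proof -
  have "(\<Sum>j=1..k. vilenkin_partial_sum m f j x)
      = (\<Sum>j=1..k. \<Sum>i<j. (\<Sum>t\<in>trunc_group L. f L t * char_prod i x t) / of_nat (M L))"
  proof (intro sum.cong refl)
    fix j assume j: "j \<in> {1..k}"
    have "vilenkin_partial_sum m f j x
        = (\<Sum>i<j. (\<Sum>t\<in>trunc_group L. f L t * cnj (vilenkin_fun m i t)) / of_nat (M L)
            * vilenkin_fun m i x)"
      unfolding vilenkin_partial_sum_def using j k
      by (intro sum.cong refl) (simp add: vilenkin_coeff_martingale[OF f, of _ L])
    also have "\<dots> = (\<Sum>i<j. (\<Sum>t\<in>trunc_group L. f L t * char_prod i x t) / of_nat (M L))"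
      unfolding char_prod_def sum_divide_distrib sum_distrib_right
      by (intro sum.cong refl) (simp add: mult_ac)
    finally show "vilenkin_partial_sum m f j x = \<dots>" .
  qed
  also have "\<dots> = (\<Sum>j=1..k. \<Sum>t\<in>trunc_group L. f L t * dirichlet j x t) / of_nat (M L)"
    unfolding dirichlet_def sum_distrib_left sum_divide_distrib
    by (intro sum.cong refl sum.swap)
  also have "\<dots> = (\<Sum>t\<in>trunc_group L. f L t * fejer_sum k x t) / of_nat (M L)"
    unfolding fejer_sum_def sum_distrib_left by (subst sum.swap) simp
  finally show ?thesis by (simp add: fejer_mean_def fejer_op_def mult.commute)
qed

lemma nn_integral_fejer_mean:
  assumes f: "vilenkin_martingale m f" and k: "k < M L"
  shows "(\<integral>\<^sup>+ x. ennpowr (ennreal (cmod (fejer_mean m f k x))) p \<partial>\<mu>)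
    = ennreal ((\<Sum>x\<in>trunc_group L. cmod (fejer_op L k (f L) x) powr p) / real (M L))"
proof -
  have "(\<integral>\<^sup>+ x. ennpowr (ennreal (cmod (fejer_mean m f k x))) p \<partial>\<mu>)
      = (\<integral>\<^sup>+ x. ennreal (cmod (fejer_op L k (f L) x) powr p) \<partial>\<mu>)"
    by (simp add: fejer_mean_eq_fejer_op[OF f k] ennpowr_ennreal)
  also have "\<dots> = (\<Sum>v\<in>trunc_group L. ennreal (cmod (fejer_op L k (f L) v) powr p)
      * ennreal (1 / real (M L)))"
  proof (rule nn_integral_cylinder)
    fix x
    have "vilenkin_fun m j x = vilenkin_fun m j (restrict_point L x)" if "j < M L" for j
      using that agree_restrict_point by (rule vilenkin_fun_cong)
    then have "fejer_sum k x t = fejer_sum k (restrict_point L x) t" for t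
      unfolding fejer_sum_def dirichlet_def char_prod_def using k by (intro sum.cong refl) auto
    then show "ennreal (cmod (fejer_op L k (f L) x) powr p)
        = ennreal (cmod (fejer_op L k (f L) (restrict_point L x)) powr p)"
      by (simp add: fejer_op_def)
  qed
  also have "\<dots> = ennreal ((\<Sum>x\<in>trunc_group L. cmod (fejer_op L k (f L) x) powr p) / real (M L))"
    by (simp add: sum_divide_distrib flip: ennreal_mult)
  finally show ?thesis .
qed

text \<open>The maximal function over finitely many times is a lower bound for \<open>f\<^sup>*\<close>, whether or not
  the latter is finite at a given point.\<close>

lemma ennpowr_Hardy_norm_ge:
  assumes f: "vilenkin_martingale m f" and p: "0 < p"
  shows "ennreal ((\<Sum>x\<in>trunc_group L. truncated_martingale.fmax L f x powr p) / real (M L))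
    \<le> ennpowr (Hardy_norm m p f) p"
proof -
  interpret truncated_martingale m B L f by (rule truncated_martingaleI[OF f])
  have "ennreal ((\<Sum>x\<in>trunc_group L. fmax x powr p) / real (M L))
      = (\<Sum>v\<in>trunc_group L. ennreal (fmax v powr p) * ennreal (1 / real (M L)))"
    by (simp add: sum_divide_distrib flip: ennreal_mult)
  also have "\<dots> = (\<integral>\<^sup>+ x. ennreal (fmax x powr p) \<partial>\<mu>)"
  proof (rule nn_integral_cylinder[symmetric])
    fix x assume x: "x \<in> vilenkin_group m"
    have "f i x = f i (restrict_point L x)" if "i \<le> L" for i
    proof (rule filtration_measurable_constant[of "f i" i x "restrict_point L x"])
      show "f i \<in> borel_measurable (vilenkin_filtration m i)" using f
        by (simp add: vilenkin_martingale_def)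
      show "restrict_point L x \<in> vilenkin_group m"
        using restrict_point_in[OF x] trunc_group_subset by blast
      show "agree i x (restrict_point L x)" using agree_restrict_point that by (rule agree_mono)
    qed (rule x)
    then have "(\<lambda>i. cmod (f i x)) ` {..L} = (\<lambda>i. cmod (f i (restrict_point L x))) ` {..L}"
      by (intro image_cong) auto
    then show "ennreal (fmax x powr p) = ennreal (fmax (restrict_point L x) powr p)"
      by (simp add: fmax_def)
  qed
  also have "\<dots> \<le> (\<integral>\<^sup>+ x. ennpowr (maximal_fun f x) p \<partial>\<mu>)"
  proof (rule nn_integral_mono)
    fix x
    have "fmax x \<in> (\<lambda>i. cmod (f i x)) ` {..L}" unfolding fmax_def by (intro Max_in) auto
    then obtain i where "fmax x = cmod (f i x)" by blast
    then have le: "ennreal (fmax x) \<le> maximal_fun f x"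
      using SUP_upper[of i UNIV "\<lambda>i. ennreal (cmod (f i x))"] by (simp add: maximal_fun_def)
    show "ennreal (fmax x powr p) \<le> ennpowr (maximal_fun f x) p"
    proof (cases "maximal_fun f x = \<infinity>")
      case False
      then have "fmax x \<le> enn2real (maximal_fun f x)"
        using enn2real_mono[OF le] fmax_nonneg by (simp add: less_top)
      then show ?thesis using False p fmax_nonneg
        by (auto simp: ennpowr_def intro!: ennreal_leI powr_mono2)
    qed (simp add: ennpowr_def)
  qed
  also have "\<dots> = ennpowr (Hardy_norm m p f) p"
    unfolding Hardy_norm_def using p by (rule ennpowr_vilenkin_Lp_norm[symmetric])
  finally show ?thesis .
qed

end

section \<open>Strong summability of Fejer means\<close>

context bounded_vilenkin
begin

lemma fejer_means_strong_summability:
  assumes p: "0 < p" "p \<le> 1 / 2"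
  shows "\<exists>c>0. \<forall>f\<in>Hardy_space m p. \<forall>n\<ge>2.
    ennreal (1 / log_factor p n) *
      (\<Sum>k=1..n. ennpowr (vilenkin_Lp_norm m p (\<lambda>x. ennreal (cmod (fejer_mean m f k x)))) p
                   / ennreal (real k powr (2 - 2 * p)))
    \<le> ennreal c * ennpowr (Hardy_norm m p f) p"
proof -
  obtain C where C: "0 < C" "atom_bound p C" using atom_estimate[OF p] by blast
  define c where "c = C * (6 powr p * B / (1 - 2 powr (-p)) + 1)"
  have r: "2 powr (-p) < (1::real)" using p by (simp add: powr_less_one)
  have c: "0 < c" unfolding c_def using C r by (intro mult_pos_pos add_nonneg_pos) auto
  have "ennreal (1 / log_factor p n) *
      (\<Sum>k=1..n. ennpowr (vilenkin_Lp_norm m p (\<lambda>x. ennreal (cmod (fejer_mean m f k x)))) p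
                   / ennreal (real k powr (2 - 2 * p)))
    \<le> ennreal c * ennpowr (Hardy_norm m p f) p"
    if "f \<in> Hardy_space m p" and n: "2 \<le> n" for f n
  proof -
    have f: "vilenkin_martingale m f" using that(1) by (simp add: Hardy_space_def)
    \<comment> \<open>Any level with n < M L will do, and n < M n.\<close>
    define L where "L = n"
    have nL: "n < M L" unfolding L_def using vilenkin_base_gt[of m n] m_ge_2 by blast
    interpret truncated_martingale m B L f by (rule truncated_martingaleI[OF f])
    have l: "0 < log_factor p n" using n by (rule log_factor_pos)
    let ?S = "\<lambda>k. \<Sum>x\<in>trunc_group L. cmod (fejer_op L k (f L) x) powr p"
    let ?H = "\<Sum>x\<in>trunc_group L. fmax x powr p"
    have S0: "0 \<le> ?S k" for k by (intro sum_nonneg) simp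
    have "(\<Sum>k=1..n. ennpowr (vilenkin_Lp_norm m p (\<lambda>x. ennreal (cmod (fejer_mean m f k x)))) p
                   / ennreal (real k powr (2 - 2 * p)))
        = (\<Sum>k=1..n. ennreal (real k powr (2 * p - 2) * ?S k / real (M L)))"
    proof (rule sum.cong[OF refl])
      fix k assume k: "k \<in> {1..n}"
      then have "k < M L" using nL by simp
      then have "ennpowr (vilenkin_Lp_norm m p (\<lambda>x. ennreal (cmod (fejer_mean m f k x)))) p
                   / ennreal (real k powr (2 - 2 * p))
          = ennreal (?S k / real (M L)) / ennreal (real k powr (2 - 2 * p))"
        using nn_integral_fejer_mean[OF f] p by (simp add: ennpowr_vilenkin_Lp_norm)
      also have "\<dots> = ennreal (?S k / real (M L) / real k powr (2 - 2 * p))"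
        using k S0 by (intro divide_ennreal) auto
      also have "?S k / real (M L) / real k powr (2 - 2 * p)
          = real k powr (2 * p - 2) * ?S k / real (M L)"
      proof -
        have "real k powr (2 * p - 2) = 1 / real k powr (2 - 2 * p)"
          using powr_minus[of "real k" "2 - 2 * p"] by (simp add: divide_inverse)
        then show ?thesis by (simp add: mult.commute)
      qed
      finally show "ennpowr (vilenkin_Lp_norm m p (\<lambda>x. ennreal (cmod (fejer_mean m f k x)))) p
                   / ennreal (real k powr (2 - 2 * p))
          = ennreal (real k powr (2 * p - 2) * ?S k / real (M L))" .
    qed
    also have "\<dots> = ennreal (fejer_energy L p n (f L) / real (M L))"
      using S0 unfolding fejer_energy_def sum_divide_distrib by (intro sum_ennreal) auto
    finally have energy: "(\<Sum>k=1..n. ennpowr (vilenkin_Lp_norm m p (\<lambda>x. ennreal (cmod (fejer_mean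
        m f k x)))) p
                   / ennreal (real k powr (2 - 2 * p)))
        = ennreal (fejer_energy L p n (f L) / real (M L))" .
    have "ennreal (1 / log_factor p n) *
        (\<Sum>k=1..n. ennpowr (vilenkin_Lp_norm m p (\<lambda>x. ennreal (cmod (fejer_mean m f k x)))) p
                   / ennreal (real k powr (2 - 2 * p)))
        = ennreal (1 / log_factor p n * (fejer_energy L p n (f L) / real (M L)))"
      unfolding energy using l by (subst ennreal_mult') auto
    also have "\<dots> \<le> ennreal (1 / log_factor p n * (c * log_factor p n * ?H / real (M L)))"
      using fejer_energy_le[OF C(2,1) p n nL] l unfolding c_def
      by (intro ennreal_leI mult_left_mono divide_right_mono) auto
    also have "1 / log_factor p n * (c * log_factor p n * ?H / real (M L))
        = c * (?H / real (M L))"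
      using l by simp
    also have "ennreal (c * (?H / real (M L))) = ennreal c * ennreal (?H / real (M L))"
      using c by (intro ennreal_mult) (auto intro!: sum_nonneg divide_nonneg_nonneg)
    also have "\<dots> \<le> ennreal c * ennpowr (Hardy_norm m p f) p"
      by (intro mult_left_mono ennpowr_Hardy_norm_ge f p) simp
    finally show ?thesis .
  qed
  with c show ?thesis by blast
qed

end

theorem theorem1:
  fixes m :: "nat \<Rightarrow> nat" and p :: real
  assumes "\<And>k. 2 \<le> m k" and "bdd_above (range m)"
    and "0 < p" and "p \<le> 1 / 2"
  shows "\<exists>c::real. 0 < c \<and>
    (\<forall>f \<in> Hardy_space m p. \<forall>n::nat. 2 \<le> n \<longrightarrow>
      ennreal (1 / ln (real n) ^ nat \<lfloor>1 / 2 + p\<rfloor>) *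
        (\<Sum>k=1..n. ennpowr (vilenkin_Lp_norm m p (\<lambda>x. ennreal (cmod (fejer_mean m f k x)))) p
                     / ennreal (real k powr (2 - 2 * p)))
      \<le> ennreal c * ennpowr (Hardy_norm m p f) p)"
proof -
  obtain B where "\<And>k. m k \<le> B" using assms(2) by (auto simp: bdd_above_def)
  then interpret bounded_vilenkin m B using assms(1) by unfold_locales
  show ?thesis
    using fejer_means_strong_summability[OF assms(3,4)] unfolding log_factor_def .
qed

end
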